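(* Moore's conjecture holds for the Thompson group $$T=\langle x_0,x_1,x_2,\dots,x_n,\dots : x_n^{x_i}=x_{n+1}\ \text{for every } i<n\rangle.$$
   Context: Here $x^{y}=y^{-1}xy$. All rings have a unit element $1$. For a group $\Gamma$ and a ring $R$, a strongly graded ring $R(\Gamma)$ over $R$ is a ring with an additive decomposition $R(\Gamma)=\bigoplus_{\gamma\in\Gamma}R_\gamma$ such that $R_\gamma R_\tau=R_{\gamma\tau}$ for all $\gamma,\tau\in\Gamma$ and $R_e=R$. For a subgroup $U\le\Gamma$, $R(U)=\bigoplus_{\gamma\in U}R_\gamma$ denotes the corresponding subring. Let $H$ be a subgroup of finite index of $\Gamma$. Moore's condition holds for the triple $(\Gamma,H,R)$ if for every nontrivial element $x\in\Gamma$ at least one of the following holds: (M1) $\langle x\rangle\cap H\neq\{e\}$; (M2) $\mathrm{ord}(x)$ is finite and invertible in $R$. Moore's conjecture holds for the triple $(\Gamma,H,R)$ if Moore's condition for $(\Gamma,H,R)$ implies that, for every strongly graded ring $R(\Gamma)$ over $R$, every $R(\Gamma)$-module $M$ which is projective over $R(H)$ is projective over $R(\Gamma)$. Moore's conjecture holds for the group $\Gamma$ if it holds for $(\Gamma,H,R)$ for every ring $R$ and every subgroup $H$ of finite index in $\Gamma$. *)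

theory Defs
  imports "HOL-Algebra.Algebra"
begin

section \<open>Modules over a not necessarily commutative ring\<close>

text \<open>
  The locale \<^locale>\<open>module\<close> of HOL-Algebra assumes the ring of scalars to be commutative; the axioms
  below are otherwise the same.
\<close>

locale left_module = R?: ring R + M?: abelian_group M
  for R :: "('r, 'n) ring_scheme" (structure) and M :: "('r, 'm) module" (structure) +
  assumes smult_closed [simp, intro]:
      "\<lbrakk>a \<in> carrier R; x \<in> carrier M\<rbrakk> \<Longrightarrow> a \<odot>\<^bsub>M\<^esub> x \<in> carrier M"
    and smult_l_distr:
      "\<lbrakk>a \<in> carrier R; b \<in> carrier R; x \<in> carrier M\<rbrakk> \<Longrightarrow>
        (a \<oplus>\<^bsub>R\<^esub> b) \<odot>\<^bsub>M\<^esub> x = a \<odot>\<^bsub>M\<^esub> x \<oplus>\<^bsub>M\<^esub> b \<odot>\<^bsub>M\<^esub> x"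
    and smult_r_distr:
      "\<lbrakk>a \<in> carrier R; x \<in> carrier M; y \<in> carrier M\<rbrakk> \<Longrightarrow>
        a \<odot>\<^bsub>M\<^esub> (x \<oplus>\<^bsub>M\<^esub> y) = a \<odot>\<^bsub>M\<^esub> x \<oplus>\<^bsub>M\<^esub> a \<odot>\<^bsub>M\<^esub> y"
    and smult_assoc1:
      "\<lbrakk>a \<in> carrier R; b \<in> carrier R; x \<in> carrier M\<rbrakk> \<Longrightarrow>
        (a \<otimes>\<^bsub>R\<^esub> b) \<odot>\<^bsub>M\<^esub> x = a \<odot>\<^bsub>M\<^esub> (b \<odot>\<^bsub>M\<^esub> x)"
    and smult_one [simp]:
      "x \<in> carrier M \<Longrightarrow> \<one>\<^bsub>R\<^esub> \<odot>\<^bsub>M\<^esub> x = x"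

definition linear_maps ::
    "('r, 'n) ring_scheme \<Rightarrow> ('r, 'a) module \<Rightarrow> ('r, 'b) module \<Rightarrow> ('a \<Rightarrow> 'b) set"
  where "linear_maps R M N =
    {f \<in> carrier M \<rightarrow> carrier N.
      (\<forall>x\<in>carrier M. \<forall>y\<in>carrier M. f (x \<oplus>\<^bsub>M\<^esub> y) = f x \<oplus>\<^bsub>N\<^esub> f y) \<and>
      (\<forall>r\<in>carrier R. \<forall>x\<in>carrier M. f (r \<odot>\<^bsub>M\<^esub> x) = r \<odot>\<^bsub>N\<^esub> f x)}"

definition lifts_against ::
    "('r, 'n) ring_scheme \<Rightarrow> ('r, 'm) module \<Rightarrow> ('r, 'a) module \<Rightarrow> ('r, 'b) module \<Rightarrow> bool"
  where "lifts_against R M A B \<longleftrightarrow>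
    (\<forall>g\<in>linear_maps R A B. g ` carrier A = carrier B \<longrightarrow>
      (\<forall>h\<in>linear_maps R M B. \<exists>k\<in>linear_maps R M A. \<forall>x\<in>carrier M. g (k x) = h x))"

text \<open>
  A definition cannot quantify over all carrier types of the test modules \<open>A\<close> and \<open>B\<close>.  The types
  below are large enough to contain the free module on \<open>carrier M\<close> and \<open>M\<close> itself, so no generality
  is lost: by \<open>projective_module_lifts\<close> the lifting property follows for test modules of any type.
\<close>

definition projective_module :: "('r, 'n) ring_scheme \<Rightarrow> ('r, 'm) module \<Rightarrow> bool"
  where "projective_module R M \<longleftrightarrow> left_module R M \<and>
    (\<forall>(A :: ('r, 'm \<Rightarrow> 'r) module) (B :: ('r, 'm) module).
      left_module R A \<longrightarrow> left_module R B \<longrightarrow> lifts_against R M A B)"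

definition free_module :: "('r, 'n) ring_scheme \<Rightarrow> 'x set \<Rightarrow> ('r, 'x \<Rightarrow> 'r) module"
  where "free_module R J =
    \<lparr>carrier = {f. (\<forall>x\<in>J. f x \<in> carrier R) \<and> (\<forall>x. x \<notin> J \<longrightarrow> f x = \<zero>\<^bsub>R\<^esub>) \<and>
                  finite {x. f x \<noteq> \<zero>\<^bsub>R\<^esub>}},
     monoid.mult = undefined, one = undefined,
     ring.zero = (\<lambda>x. \<zero>\<^bsub>R\<^esub>), add = (\<lambda>f g x. f x \<oplus>\<^bsub>R\<^esub> g x), smult = (\<lambda>r f x. r \<otimes>\<^bsub>R\<^esub> f x)\<rparr>"

lemma (in ring) free_module_left_module:
  "left_module R (free_module R J)"
proof -
  let ?F = "free_module R J"
  have car: "f x \<in> carrier R" if "f \<in> carrier ?F" for f x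
    using that by (cases "x \<in> J") (auto simp: free_module_def)
  have ab: "abelian_group ?F"
  proof (rule abelian_groupI)
    fix f g assume fg: "f \<in> carrier ?F" "g \<in> carrier ?F"
    have "{x. f x \<oplus> g x \<noteq> \<zero>} \<subseteq> {x. f x \<noteq> \<zero>} \<union> {x. g x \<noteq> \<zero>}" by auto
    moreover have "finite ({x. f x \<noteq> \<zero>} \<union> {x. g x \<noteq> \<zero>})"
      using fg by (simp add: free_module_def)
    ultimately have "finite {x. f x \<oplus> g x \<noteq> \<zero>}" by (rule finite_subset)
    then show "f \<oplus>\<^bsub>?F\<^esub> g \<in> carrier ?F"
      using fg by (simp add: free_module_def)
    show "f \<oplus>\<^bsub>?F\<^esub> g = g \<oplus>\<^bsub>?F\<^esub> f"
      using car[OF fg(1)] car[OF fg(2)] by (simp add: free_module_def a_comm)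
  next
    fix f g h assume fgh: "f \<in> carrier ?F" "g \<in> carrier ?F" "h \<in> carrier ?F"
    show "f \<oplus>\<^bsub>?F\<^esub> g \<oplus>\<^bsub>?F\<^esub> h = f \<oplus>\<^bsub>?F\<^esub> (g \<oplus>\<^bsub>?F\<^esub> h)"
      using car[OF fgh(1)] car[OF fgh(2)] car[OF fgh(3)] by (simp add: free_module_def a_assoc)
  next
    show "\<zero>\<^bsub>?F\<^esub> \<in> carrier ?F" by (simp add: free_module_def)
  next
    fix f assume f: "f \<in> carrier ?F"
    show "\<zero>\<^bsub>?F\<^esub> \<oplus>\<^bsub>?F\<^esub> f = f" using car[OF f] by (simp add: free_module_def)
    have "{x. \<ominus> f x \<noteq> \<zero>} \<subseteq> {x. f x \<noteq> \<zero>}" by auto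
    moreover have "finite {x. f x \<noteq> \<zero>}" using f by (simp add: free_module_def)
    ultimately have "finite {x. \<ominus> f x \<noteq> \<zero>}" by (rule finite_subset)
    then have "(\<lambda>x. \<ominus> f x) \<in> carrier ?F" using f by (simp add: free_module_def)
    moreover have "(\<lambda>x. \<ominus> f x) \<oplus>\<^bsub>?F\<^esub> f = \<zero>\<^bsub>?F\<^esub>"
      using car[OF f] by (simp add: free_module_def l_neg)
    ultimately show "\<exists>y\<in>carrier ?F. y \<oplus>\<^bsub>?F\<^esub> f = \<zero>\<^bsub>?F\<^esub>" by blast
  qed
  have ax: "left_module_axioms R ?F"
  proof
    fix a f assume a: "a \<in> carrier R" and f: "f \<in> carrier ?F"
    have "{x. a \<otimes> f x \<noteq> \<zero>} \<subseteq> {x. f x \<noteq> \<zero>}" using a by auto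
    moreover have "finite {x. f x \<noteq> \<zero>}" using f by (simp add: free_module_def)
    ultimately have "finite {x. a \<otimes> f x \<noteq> \<zero>}" by (rule finite_subset)
    then show "a \<odot>\<^bsub>?F\<^esub> f \<in> carrier ?F" using a f by (simp add: free_module_def)
  next
    fix a b f assume "a \<in> carrier R" "b \<in> carrier R" and f: "f \<in> carrier ?F"
    then show "(a \<oplus> b) \<odot>\<^bsub>?F\<^esub> f = a \<odot>\<^bsub>?F\<^esub> f \<oplus>\<^bsub>?F\<^esub> b \<odot>\<^bsub>?F\<^esub> f"
      and "(a \<otimes> b) \<odot>\<^bsub>?F\<^esub> f = a \<odot>\<^bsub>?F\<^esub> (b \<odot>\<^bsub>?F\<^esub> f)"
      using car[OF f] by (simp_all add: free_module_def l_distr m_assoc)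
  next
    fix a f g assume a: "a \<in> carrier R" and f: "f \<in> carrier ?F" and g: "g \<in> carrier ?F"
    show "a \<odot>\<^bsub>?F\<^esub> (f \<oplus>\<^bsub>?F\<^esub> g) = a \<odot>\<^bsub>?F\<^esub> f \<oplus>\<^bsub>?F\<^esub> a \<odot>\<^bsub>?F\<^esub> g"
      using a car[OF f] car[OF g] by (simp add: free_module_def r_distr)
  next
    fix f assume f: "f \<in> carrier ?F"
    show "\<one> \<odot>\<^bsub>?F\<^esub> f = f" using car[OF f] by (simp add: free_module_def)
  qed
  show ?thesis by (rule left_module.intro[OF ring_axioms ab ax])
qed

context left_module
begin

lemma smult_r_null: "a \<in> carrier R \<Longrightarrow> a \<odot>\<^bsub>M\<^esub> \<zero>\<^bsub>M\<^esub> = \<zero>\<^bsub>M\<^esub>"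
  using smult_r_distr[of a "\<zero>\<^bsub>M\<^esub>" "\<zero>\<^bsub>M\<^esub>"] by simp

lemma smult_l_null: "x \<in> carrier M \<Longrightarrow> \<zero>\<^bsub>R\<^esub> \<odot>\<^bsub>M\<^esub> x = \<zero>\<^bsub>M\<^esub>"
  using smult_l_distr[of "\<zero>\<^bsub>R\<^esub>" "\<zero>\<^bsub>R\<^esub>" x] by simp

lemma finsum_smult:
  assumes "finite S" and "a \<in> carrier R" and "\<And>x. x \<in> S \<Longrightarrow> f x \<in> carrier M"
  shows "a \<odot>\<^bsub>M\<^esub> finsum M f S = finsum M (\<lambda>x. a \<odot>\<^bsub>M\<^esub> f x) S"
  using assms
proof (induction S rule: finite_induct)
  case empty
  then show ?case by (simp add: smult_r_null)
next
  case (insert y S)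
  then show ?case by (simp add: smult_r_distr Pi_def)
qed

lemma linear_maps_zero:
  assumes "left_module R N" and "f \<in> linear_maps R M N"
  shows "f \<zero>\<^bsub>M\<^esub> = \<zero>\<^bsub>N\<^esub>"
proof -
  interpret N: left_module R N by fact
  have "f \<zero>\<^bsub>M\<^esub> = f (\<zero>\<^bsub>M\<^esub> \<oplus>\<^bsub>M\<^esub> \<zero>\<^bsub>M\<^esub>)" by simp
  also have "\<dots> = f \<zero>\<^bsub>M\<^esub> \<oplus>\<^bsub>N\<^esub> f \<zero>\<^bsub>M\<^esub>"
    using assms(2) M.zero_closed unfolding linear_maps_def by blast
  finally have "f \<zero>\<^bsub>M\<^esub> = f \<zero>\<^bsub>M\<^esub> \<oplus>\<^bsub>N\<^esub> f \<zero>\<^bsub>M\<^esub>" .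
  moreover have "f \<zero>\<^bsub>M\<^esub> \<in> carrier N" using assms(2) by (auto simp: linear_maps_def)
  ultimately show ?thesis by simp
qed

lemma linear_maps_finsum:
  assumes N: "left_module R N" and f: "f \<in> linear_maps R M N"
    and "finite S" and "\<And>x. x \<in> S \<Longrightarrow> g x \<in> carrier M"
  shows "f (finsum M g S) = finsum N (\<lambda>x. f (g x)) S"
  using assms(3,4)
proof (induction S rule: finite_induct)
  interpret N: left_module R N by fact
  {
    case empty
    then show ?case by (simp add: linear_maps_zero[OF N f])
  next
    case (insert y S)
    have "f (g y \<oplus>\<^bsub>M\<^esub> finsum M g S) = f (g y) \<oplus>\<^bsub>N\<^esub> f (finsum M g S)"
      using f insert.prems by (simp add: linear_maps_def)
    then show ?case using insert f by (simp add: Pi_def linear_maps_def)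
  }
qed

definition free_ext :: "('x \<Rightarrow> 'm) \<Rightarrow> ('x \<Rightarrow> 'r) \<Rightarrow> 'm"
  where "free_ext \<phi> f = finsum M (\<lambda>x. f x \<odot>\<^bsub>M\<^esub> \<phi> x) {x. f x \<noteq> \<zero>\<^bsub>R\<^esub>}"

lemma free_ext_eq:
  assumes "f \<in> carrier (free_module R J)" and "\<phi> \<in> J \<rightarrow> carrier M"
    and "finite S" and "{x. f x \<noteq> \<zero>\<^bsub>R\<^esub>} \<subseteq> S" and "S \<subseteq> J"
  shows "free_ext \<phi> f = finsum M (\<lambda>x. f x \<odot>\<^bsub>M\<^esub> \<phi> x) S"
  unfolding free_ext_def
proof (rule M.add.finprod_mono_neutral_cong_left[OF assms(3,4)])
  show "f x \<odot>\<^bsub>M\<^esub> \<phi> x = \<zero>\<^bsub>M\<^esub>" if "x \<in> S - {x. f x \<noteq> \<zero>\<^bsub>R\<^esub>}" for x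
    using that assms(2,5) by (auto simp: smult_l_null Pi_def subset_iff)
  show "(\<lambda>x. f x \<odot>\<^bsub>M\<^esub> \<phi> x) \<in> S \<rightarrow> carrier M"
    using assms(1,2,5) by (auto simp: free_module_def Pi_def subset_iff)
qed simp

lemma free_supp:
  assumes "f \<in> carrier (free_module R J)"
  shows "finite {x. f x \<noteq> \<zero>\<^bsub>R\<^esub>}" and "{x. f x \<noteq> \<zero>\<^bsub>R\<^esub>} \<subseteq> J"
  using assms by (auto simp: free_module_def)

lemma free_ext_hom:
  assumes \<phi>: "\<phi> \<in> J \<rightarrow> carrier M"
  shows "free_ext \<phi> \<in> linear_maps R (free_module R J) M"
proof -
  let ?F = "free_module R J"
  interpret F: left_module R ?F by (rule R.free_module_left_module)
  have tm: "f x \<odot>\<^bsub>M\<^esub> \<phi> x \<in> carrier M" if "f \<in> carrier ?F" "x \<in> J" for f x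
    using that \<phi> by (auto simp: free_module_def Pi_def)
  have closed: "free_ext \<phi> f \<in> carrier M" if f: "f \<in> carrier ?F" for f
    unfolding free_ext_def using free_supp(2)[OF f] by (intro M.finsum_closed) (auto intro!: tm[OF f])
  have add: "free_ext \<phi> (f \<oplus>\<^bsub>?F\<^esub> g) = free_ext \<phi> f \<oplus>\<^bsub>M\<^esub> free_ext \<phi> g"
    if f: "f \<in> carrier ?F" and g: "g \<in> carrier ?F" for f g
  proof -
    let ?S = "{x. f x \<noteq> \<zero>\<^bsub>R\<^esub>} \<union> {x. g x \<noteq> \<zero>\<^bsub>R\<^esub>}"
    have S: "finite ?S" "?S \<subseteq> J" using free_supp[OF f] free_supp[OF g] by auto
    have fg: "f \<oplus>\<^bsub>?F\<^esub> g \<in> carrier ?F" using f g by (rule F.a_closed)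
    have sub: "{x. (f \<oplus>\<^bsub>?F\<^esub> g) x \<noteq> \<zero>\<^bsub>R\<^esub>} \<subseteq> ?S" by (auto simp: free_module_def)
    have "free_ext \<phi> (f \<oplus>\<^bsub>?F\<^esub> g) = finsum M (\<lambda>x. (f \<oplus>\<^bsub>?F\<^esub> g) x \<odot>\<^bsub>M\<^esub> \<phi> x) ?S"
      by (rule free_ext_eq[OF fg \<phi> S(1) sub S(2)])
    also have "\<dots> = finsum M (\<lambda>x. f x \<odot>\<^bsub>M\<^esub> \<phi> x \<oplus>\<^bsub>M\<^esub> g x \<odot>\<^bsub>M\<^esub> \<phi> x) ?S"
    proof (rule M.finsum_cong')
      show "(f \<oplus>\<^bsub>?F\<^esub> g) x \<odot>\<^bsub>M\<^esub> \<phi> x = f x \<odot>\<^bsub>M\<^esub> \<phi> x \<oplus>\<^bsub>M\<^esub> g x \<odot>\<^bsub>M\<^esub> \<phi> x" if "x \<in> ?S" for x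
      proof -
        have "x \<in> J" using that S(2) by blast
        then show ?thesis using f g \<phi> by (auto simp: free_module_def Pi_def smult_l_distr)
      qed
      show "(\<lambda>x. f x \<odot>\<^bsub>M\<^esub> \<phi> x \<oplus>\<^bsub>M\<^esub> g x \<odot>\<^bsub>M\<^esub> \<phi> x) \<in> ?S \<rightarrow> carrier M"
        using S(2) by (intro Pi_I M.a_closed tm f g) auto
    qed simp
    also have "\<dots> = finsum M (\<lambda>x. f x \<odot>\<^bsub>M\<^esub> \<phi> x) ?S \<oplus>\<^bsub>M\<^esub> finsum M (\<lambda>x. g x \<odot>\<^bsub>M\<^esub> \<phi> x) ?S"
      using S(2) by (intro M.finsum_addf Pi_I tm f g) auto
    also have "finsum M (\<lambda>x. f x \<odot>\<^bsub>M\<^esub> \<phi> x) ?S = free_ext \<phi> f"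
      by (rule free_ext_eq[OF f \<phi> S(1) _ S(2), symmetric]) auto
    also have "finsum M (\<lambda>x. g x \<odot>\<^bsub>M\<^esub> \<phi> x) ?S = free_ext \<phi> g"
      by (rule free_ext_eq[OF g \<phi> S(1) _ S(2), symmetric]) auto
    finally show ?thesis .
  qed
  have smult: "free_ext \<phi> (r \<odot>\<^bsub>?F\<^esub> f) = r \<odot>\<^bsub>M\<^esub> free_ext \<phi> f"
    if r: "r \<in> carrier R" and f: "f \<in> carrier ?F" for r f
  proof -
    let ?S = "{x. f x \<noteq> \<zero>\<^bsub>R\<^esub>}"
    have rf: "r \<odot>\<^bsub>?F\<^esub> f \<in> carrier ?F" using r f by (rule F.smult_closed)
    have sub: "{x. (r \<odot>\<^bsub>?F\<^esub> f) x \<noteq> \<zero>\<^bsub>R\<^esub>} \<subseteq> ?S" using r by (auto simp: free_module_def)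
    have "free_ext \<phi> (r \<odot>\<^bsub>?F\<^esub> f) = finsum M (\<lambda>x. (r \<odot>\<^bsub>?F\<^esub> f) x \<odot>\<^bsub>M\<^esub> \<phi> x) ?S"
      by (rule free_ext_eq[OF rf \<phi> free_supp(1)[OF f] sub free_supp(2)[OF f]])
    also have "\<dots> = finsum M (\<lambda>x. r \<odot>\<^bsub>M\<^esub> (f x \<odot>\<^bsub>M\<^esub> \<phi> x)) ?S"
    proof (rule M.finsum_cong')
      show "(r \<odot>\<^bsub>?F\<^esub> f) x \<odot>\<^bsub>M\<^esub> \<phi> x = r \<odot>\<^bsub>M\<^esub> (f x \<odot>\<^bsub>M\<^esub> \<phi> x)" if "x \<in> ?S" for x
      proof -
        have "x \<in> J" using that free_supp(2)[OF f] by blast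
        then show ?thesis using r f \<phi> by (auto simp: free_module_def Pi_def smult_assoc1)
      qed
      show "(\<lambda>x. r \<odot>\<^bsub>M\<^esub> (f x \<odot>\<^bsub>M\<^esub> \<phi> x)) \<in> ?S \<rightarrow> carrier M"
        using free_supp(2)[OF f] by (intro Pi_I smult_closed r tm f) auto
    qed simp
    also have "\<dots> = r \<odot>\<^bsub>M\<^esub> free_ext \<phi> f"
      unfolding free_ext_def using free_supp[OF f]
      by (intro finsum_smult[symmetric] r tm f) auto
    finally show ?thesis .
  qed
  show ?thesis using closed add smult by (simp add: linear_maps_def)
qed

lemma free_ext_surj:
  "free_ext id ` carrier (free_module R (carrier M)) = carrier M"
proof
  show "free_ext id ` carrier (free_module R (carrier M)) \<subseteq> carrier M"
    using free_ext_hom[of id "carrier M"] by (auto simp: linear_maps_def)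
next
  show "carrier M \<subseteq> free_ext id ` carrier (free_module R (carrier M))"
  proof
    fix x assume x: "x \<in> carrier M"
    let ?d = "(\<lambda>y. if y = x then \<one>\<^bsub>R\<^esub> else \<zero>\<^bsub>R\<^esub>)"
    have "{y. ?d y \<noteq> \<zero>\<^bsub>R\<^esub>} \<subseteq> {x}" by auto
    then have d: "?d \<in> carrier (free_module R (carrier M))"
      using x by (auto simp: free_module_def intro: finite_subset)
    have "free_ext id ?d = finsum M (\<lambda>y. ?d y \<odot>\<^bsub>M\<^esub> id y) {x}"
      by (rule free_ext_eq[OF d]) (use x in auto)
    also have "\<dots> = x" using x by simp
    finally show "x \<in> free_ext id ` carrier (free_module R (carrier M))" using d by (metis imageI)
  qed
qed

end

lemma projective_module_lifts:
  assumes "projective_module R M" and A: "left_module R A" and B: "left_module R B"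
  shows "lifts_against R M A B"
  unfolding lifts_against_def
proof (intro ballI impI)
  fix g h
  assume g: "g \<in> linear_maps R A B" and surj: "g ` carrier A = carrier B"
    and h: "h \<in> linear_maps R M B"
  interpret M: left_module R M using assms(1) by (simp add: projective_module_def)
  interpret A: left_module R A by fact
  interpret B: left_module R B by fact
  let ?F = "free_module R (carrier M)"
  have "lifts_against R M ?F M"
    using assms(1) M.R.free_module_left_module M.left_module_axioms
    unfolding projective_module_def by blast
  moreover have "M.free_ext id \<in> linear_maps R ?F M" by (rule M.free_ext_hom) simp
  moreover have "id \<in> linear_maps R M M" by (simp add: linear_maps_def)
  ultimately have "\<exists>s\<in>linear_maps R M ?F. \<forall>x\<in>carrier M. M.free_ext id (s x) = id x"
    using M.free_ext_surj unfolding lifts_against_def by blast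
  then obtain s where s: "s \<in> linear_maps R M ?F"
    and sx: "\<And>x. x \<in> carrier M \<Longrightarrow> M.free_ext id (s x) = x"
    by auto
  have hB: "h x \<in> carrier B" if "x \<in> carrier M" for x
    using h that by (auto simp: linear_maps_def)
  have "\<forall>x\<in>carrier M. \<exists>a\<in>carrier A. g a = h x" using surj hB by (metis imageE)
  then obtain \<phi> where \<phi>: "\<And>x. x \<in> carrier M \<Longrightarrow> \<phi> x \<in> carrier A \<and> g (\<phi> x) = h x" by metis
  then have \<phi>A: "\<phi> \<in> carrier M \<rightarrow> carrier A" by blast
  have E: "A.free_ext \<phi> \<in> linear_maps R ?F A" by (rule A.free_ext_hom[OF \<phi>A])
  have ghE: "g (A.free_ext \<phi> f) = h (M.free_ext id f)" if f: "f \<in> carrier ?F" for f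
  proof -
    let ?S = "{x. f x \<noteq> \<zero>\<^bsub>R\<^esub>}"
    have fin: "finite ?S" and sub: "?S \<subseteq> carrier M" using M.free_supp[OF f] by auto
    have fR: "f x \<in> carrier R" if "x \<in> ?S" for x
      using that f sub by (auto simp: free_module_def)
    have "g (A.free_ext \<phi> f) = finsum B (\<lambda>x. g (f x \<odot>\<^bsub>A\<^esub> \<phi> x)) ?S"
      unfolding A.free_ext_def
      by (rule A.linear_maps_finsum[OF B g fin]) (use fR \<phi> sub in blast)
    also have "\<dots> = finsum B (\<lambda>x. h (f x \<odot>\<^bsub>M\<^esub> id x)) ?S"
    proof (rule B.M.finsum_cong')
      fix x assume x: "x \<in> ?S"
      then have xM: "x \<in> carrier M" using sub by blast
      show "g (f x \<odot>\<^bsub>A\<^esub> \<phi> x) = h (f x \<odot>\<^bsub>M\<^esub> id x)"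
        using g h fR[OF x] xM \<phi>[OF xM] by (simp add: linear_maps_def)
    next
      show "(\<lambda>x. h (f x \<odot>\<^bsub>M\<^esub> id x)) \<in> ?S \<rightarrow> carrier B"
      proof
        fix x assume x: "x \<in> ?S"
        then have "x \<in> carrier M" using sub by blast
        then show "h (f x \<odot>\<^bsub>M\<^esub> id x) \<in> carrier B" using fR[OF x] by (auto intro!: hB)
      qed
    qed simp
    also have "\<dots> = h (M.free_ext id f)"
      unfolding M.free_ext_def
    proof (rule M.linear_maps_finsum[OF B h fin, symmetric])
      fix x assume x: "x \<in> ?S"
      then have "x \<in> carrier M" using sub by blast
      then show "f x \<odot>\<^bsub>M\<^esub> id x \<in> carrier M" using fR[OF x] by simp
    qed
    finally show ?thesis .
  qed
  have sF: "s x \<in> carrier ?F" if "x \<in> carrier M" for x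
    using s that by (auto simp: linear_maps_def)
  show "\<exists>k\<in>linear_maps R M A. \<forall>x\<in>carrier M. g (k x) = h x"
  proof (intro bexI ballI)
    show "g (A.free_ext \<phi> (s x)) = h x" if "x \<in> carrier M" for x
      using ghE[OF sF[OF that]] sx[OF that] by simp
    show "(\<lambda>x. A.free_ext \<phi> (s x)) \<in> linear_maps R M A"
      using s E by (auto simp: linear_maps_def Pi_def)
  qed
qed


section \<open>Strongly graded rings\<close>

text \<open>A grading of \<open>S\<close> is a family \<open>A :: 'g \<Rightarrow> 's set\<close>; \<open>A \<gamma>\<close> is the component of degree \<open>\<gamma>\<close>.\<close>

definition homogeneous_families ::
    "('s, 'n) ring_scheme \<Rightarrow> ('g \<Rightarrow> 's set) \<Rightarrow> 'g set \<Rightarrow> ('g \<Rightarrow> 's) set"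
  where "homogeneous_families S A U =
    {f. (\<forall>\<gamma>\<in>U. f \<gamma> \<in> A \<gamma>) \<and> (\<forall>\<gamma>. \<gamma> \<notin> U \<longrightarrow> f \<gamma> = \<zero>\<^bsub>S\<^esub>) \<and> finite {\<gamma>. f \<gamma> \<noteq> \<zero>\<^bsub>S\<^esub>}}"

definition family_sum :: "('s, 'n) ring_scheme \<Rightarrow> ('g \<Rightarrow> 's) \<Rightarrow> 's"
  where "family_sum S f = finsum S f {\<gamma>. f \<gamma> \<noteq> \<zero>\<^bsub>S\<^esub>}"

definition graded_subring :: "('s, 'n) ring_scheme \<Rightarrow> ('g \<Rightarrow> 's set) \<Rightarrow> 'g set \<Rightarrow> ('s, 'n) ring_scheme"
  where "graded_subring S A U = S\<lparr>carrier := family_sum S ` homogeneous_families S A U\<rparr>"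

text \<open>
  \<open>A \<gamma> <#>\<^bsub>S\<^esub> A \<tau>\<close> is the set of products of elements, whereas the product of two components is the
  additive subgroup generated by it.  The equation \<open>A \<one> = R\<close> is an identification, i.e. an
  isomorphism of unital rings, so that the carrier types of \<open>R\<close> and \<open>S\<close> are independent.
\<close>

definition strongly_graded_ring ::
    "('g, 'k) monoid_scheme \<Rightarrow> ('r, 'l) ring_scheme \<Rightarrow> ('s, 'n) ring_scheme \<Rightarrow> ('g \<Rightarrow> 's set) \<Rightarrow> bool"
  where "strongly_graded_ring \<Gamma> R S A \<longleftrightarrow>
    ring S \<and>
    (\<forall>\<gamma>\<in>carrier \<Gamma>. additive_subgroup (A \<gamma>) S) \<and>
    bij_betw (family_sum S) (homogeneous_families S A (carrier \<Gamma>)) (carrier S) \<and>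
    (\<forall>\<gamma>\<in>carrier \<Gamma>. \<forall>\<tau>\<in>carrier \<Gamma>.
      generate (add_monoid S) (A \<gamma> <#>\<^bsub>S\<^esub> A \<tau>) = A (\<gamma> \<otimes>\<^bsub>\<Gamma>\<^esub> \<tau>)) \<and>
    R \<simeq> S\<lparr>carrier := A \<one>\<^bsub>\<Gamma>\<^esub>\<rparr>"


section \<open>Moore's conjecture\<close>

text \<open>By convention \<open>group.ord \<Gamma> x = 0\<close> if \<open>x\<close> has infinite order.\<close>

definition moore_condition ::
    "('g, 'k) monoid_scheme \<Rightarrow> 'g set \<Rightarrow> ('r, 'l) ring_scheme \<Rightarrow> bool"
  where "moore_condition \<Gamma> H R \<longleftrightarrow>
    (\<forall>x\<in>carrier \<Gamma> - {\<one>\<^bsub>\<Gamma>\<^esub>}.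
      generate \<Gamma> {x} \<inter> H \<noteq> {\<one>\<^bsub>\<Gamma>\<^esub>} \<or>
      (group.ord \<Gamma> x \<noteq> 0 \<and> [group.ord \<Gamma> x] \<cdot>\<^bsub>R\<^esub> \<one>\<^bsub>R\<^esub> \<in> Units R))"

text \<open>
  The type tokens stand for the carrier types of the rings \<open>R\<close> and \<open>S = R(\<Gamma>)\<close> and of the modules
  \<open>M\<close>; they are arbitrary, and a theorem about these predicates quantifies over them at top level.
\<close>

definition moore_conjecture_triple ::
    "'s itself \<Rightarrow> 'm itself \<Rightarrow> 'g monoid \<Rightarrow> 'g set \<Rightarrow> 'r ring \<Rightarrow> bool"
  where "moore_conjecture_triple TYPE('s) TYPE('m) \<Gamma> H R \<longleftrightarrow>
    (moore_condition \<Gamma> H R \<longrightarrow>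
      (\<forall>(S :: 's ring) (A :: 'g \<Rightarrow> 's set) (M :: ('s, 'm) module).
        strongly_graded_ring \<Gamma> R S A \<longrightarrow> left_module S M \<longrightarrow>
        projective_module (graded_subring S A H) M \<longrightarrow> projective_module S M))"

definition moore_conjecture ::
    "'r itself \<Rightarrow> 's itself \<Rightarrow> 'm itself \<Rightarrow> 'g monoid \<Rightarrow> bool"
  where "moore_conjecture TYPE('r) TYPE('s) TYPE('m) \<Gamma> \<longleftrightarrow>
    (\<forall>(R :: 'r ring) H. ring R \<longrightarrow> subgroup H \<Gamma> \<longrightarrow> finite (rcosets\<^bsub>\<Gamma>\<^esub> H) \<longrightarrow>
      moore_conjecture_triple TYPE('s) TYPE('m) \<Gamma> H R)"


section \<open>Group presentations and the Thompson group\<close>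

text \<open>
  A word is a list of letters, where \<open>(a, True)\<close> stands for the generator \<open>a\<close> and \<open>(a, False)\<close> for
  its inverse.  A pair \<open>(u, v)\<close> of words is the relation \<open>u = v\<close>.
\<close>

type_synonym 'a word = "('a \<times> bool) list"

inductive pres_eq :: "('a word \<times> 'a word) set \<Rightarrow> 'a word \<Rightarrow> 'a word \<Rightarrow> bool" for rels where
  rel: "(u, v) \<in> rels \<Longrightarrow> pres_eq rels u v"
| cancel: "pres_eq rels [(a, b), (a, \<not> b)] []"
| refl: "pres_eq rels u u"
| sym: "pres_eq rels u v \<Longrightarrow> pres_eq rels v u"
| trans: "pres_eq rels u v \<Longrightarrow> pres_eq rels v w \<Longrightarrow> pres_eq rels u w"
| append: "pres_eq rels u u' \<Longrightarrow> pres_eq rels v v' \<Longrightarrow> pres_eq rels (u @ v) (u' @ v')"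

definition pres_class :: "('a word \<times> 'a word) set \<Rightarrow> 'a word \<Rightarrow> 'a word set"
  where "pres_class rels u = {v. pres_eq rels u v}"

definition presented_group :: "('a word \<times> 'a word) set \<Rightarrow> 'a word set monoid"
  where "presented_group rels =
    \<lparr>carrier = range (pres_class rels),
     monoid.mult = (\<lambda>A B. \<Union>u\<in>A. \<Union>v\<in>B. pres_class rels (u @ v)),
     one = pres_class rels []\<rparr>"

lemma pres_class_eq_iff: "pres_class rels u = pres_class rels v \<longleftrightarrow> pres_eq rels u v"
  unfolding pres_class_def
  by (auto intro: pres_eq.refl pres_eq.sym pres_eq.trans)

lemma presented_group_mult:
  "pres_class rels u \<otimes>\<^bsub>presented_group rels\<^esub> pres_class rels v = pres_class rels (u @ v)"
proof -
  have "pres_class rels (u' @ v') = pres_class rels (u @ v)"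
    if "u' \<in> pres_class rels u" "v' \<in> pres_class rels v" for u' v'
    using that unfolding pres_class_eq_iff
    by (auto simp: pres_class_def intro: pres_eq.append pres_eq.sym)
  moreover have "u \<in> pres_class rels u" "v \<in> pres_class rels v"
    by (auto simp: pres_class_def intro: pres_eq.refl)
  ultimately have "(\<Union>u'\<in>pres_class rels u. \<Union>v'\<in>pres_class rels v. pres_class rels (u' @ v')) =
    pres_class rels (u @ v)"
    by blast
  then show ?thesis by (simp add: presented_group_def)
qed

lemma group_presented_group: "group (presented_group rels)"
proof (rule groupI)
  let ?G = "presented_group rels"
  have car: "carrier ?G = range (pres_class rels)" and one: "\<one>\<^bsub>?G\<^esub> = pres_class rels []"
    by (simp_all add: presented_group_def)
  show "\<one>\<^bsub>?G\<^esub> \<in> carrier ?G" by (simp add: car one)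
  fix x assume "x \<in> carrier ?G"
  then obtain u where x: "x = pres_class rels u" by (auto simp: car)
  show "\<one>\<^bsub>?G\<^esub> \<otimes>\<^bsub>?G\<^esub> x = x" by (simp add: x one presented_group_mult)
  let ?inv = "\<lambda>u. rev (map (\<lambda>(a, b). (a, \<not> b)) u)"
  have "pres_eq rels (?inv u @ u) []"
  proof (induction u)
    case Nil
    then show ?case by (simp add: pres_eq.refl)
  next
    case (Cons l u)
    obtain a b where l: "l = (a, b)" by (cases l)
    have "pres_eq rels (?inv u @ ([(a, \<not> b), (a, \<not> \<not> b)] @ u)) (?inv u @ ([] @ u))"
      by (intro pres_eq.append pres_eq.refl pres_eq.cancel)
    then show ?case using Cons by (auto simp: l intro: pres_eq.trans)
  qed
  then have "pres_class rels (?inv u) \<otimes>\<^bsub>?G\<^esub> x = \<one>\<^bsub>?G\<^esub>"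
    by (simp add: x one presented_group_mult pres_class_eq_iff)
  then show "\<exists>y\<in>carrier ?G. y \<otimes>\<^bsub>?G\<^esub> x = \<one>\<^bsub>?G\<^esub>" by (auto simp: car)
  fix y assume "y \<in> carrier ?G"
  then obtain v where y: "y = pres_class rels v" by (auto simp: car)
  show "x \<otimes>\<^bsub>?G\<^esub> y \<in> carrier ?G" by (simp add: x y car presented_group_mult)
  fix z assume "z \<in> carrier ?G"
  then obtain w where z: "z = pres_class rels w" by (auto simp: car)
  show "x \<otimes>\<^bsub>?G\<^esub> y \<otimes>\<^bsub>?G\<^esub> z = x \<otimes>\<^bsub>?G\<^esub> (y \<otimes>\<^bsub>?G\<^esub> z)"
    by (simp add: x y z presented_group_mult)
qed

text \<open>The relations \<open>x\<^sub>i\<inverse> x\<^sub>n x\<^sub>i = x\<^sub>n\<^sub>+\<^sub>1\<close> for \<open>i < n\<close>.\<close>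

definition thompson_relations :: "(nat word \<times> nat word) set"
  where "thompson_relations =
    {([(i, False), (n, True), (i, True)], [(n + 1, True)]) | i n. i < n}"

definition thompson_group :: "nat word set monoid"
  where "thompson_group = presented_group thompson_relations"

lemma group_thompson_group: "group thompson_group"
  unfolding thompson_group_def by (rule group_presented_group)

end

theory Submission
  imports Defs
begin

text \<open>
  A subgroup \<open>H\<close> of finite index in the Thompson group \<open>T\<close> contains
  the kernel of the abelianization \<open>(\<phi>\<^sub>0, \<phi>\<^sub>1) : T \<rightarrow> \<int>\<^sup>2\<close>: if \<open>x\<^sub>0\<^sup>p\<close> acts trivially on the cosets of \<open>H\<close>, then
  \<open>x\<^sub>n\<close> and \<open>x\<^sub>n\<^sub>+\<^sub>p\<close> act alike for \<open>n \<ge> 1\<close>, and \<open>x\<^sub>n\<^sub>+\<^sub>p\<^bsup>x\<^sub>n\<^esup> = x\<^sub>n\<^sub>+\<^sub>p\<^sub>+\<^sub>1\<close> makes all \<open>x\<^sub>n\<close> with \<open>n \<ge> 1\<close> act alike.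
  So there is a chain \<open>H \<le> K \<le> T\<close> in which each subgroup is the preimage of some \<open>n\<int>\<close>, \<open>n > 0\<close>,
  under a homomorphism \<open>\<psi>\<close> of the next one onto \<open>\<int>\<close>.

  For such a step \<open>H \<le> K\<close> with \<open>\<psi>(t) = 1\<close>, let \<open>\<sigma>\<close> be the action of \<open>t\<close> on maps between \<open>R(K)\<close>-modules that
  are linear over \<open>R(ker \<psi>)\<close>; its fixed points are the \<open>R(K)\<close>-linear maps.  Given an \<open>R(H)\<close>-linear lift
  \<open>s : M \<rightarrow> P\<close> of an \<open>R(K)\<close>-linear map along \<open>g : P \<rightarrow> Q\<close>,
  the map \<open>c = \<sigma> s - s\<close> is \<open>R(H)\<close>-linear into \<open>B = ker g\<close>.  Projectivity over
  \<open>R(H)\<close>, applied to an extension of \<open>M\<close> by \<open>B\<close>, gives \<open>w : M \<rightarrow> B\<close> with \<open>w - \<sigma>\<^sup>n w = c\<close>, and then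
  \<open>s + w + \<sigma> w + \<dots> + \<sigma>\<^sup>n\<^sup>-\<^sup>1 w\<close> is a \<open>\<sigma>\<close>-invariant lift.
\<close>

section \<open>Groups\<close>

text \<open>Additivity is asked for on a subgroup because the \<psi> of the lower step involves an
  integer division that is exact on \<open>K\<close>. With \<psi> constantly 0 the first conclusion
  is closure of \<open>H\<close> under integer powers.\<close>

lemma (in group) additive_int_pow:
  fixes \<psi> :: "'a \<Rightarrow> int" and k :: int
  assumes H: "subgroup H G" and \<psi>: "\<And>x y. \<lbrakk>x \<in> H; y \<in> H\<rbrakk> \<Longrightarrow> \<psi> (x \<otimes> y) = \<psi> x + \<psi> y"
    and x: "x \<in> H"
  shows "x [^] k \<in> H" and "\<psi> (x [^] k) = k * \<psi> x"
proof -
  interpret H: subgroup H G by fact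
  have \<psi>1: "\<psi> \<one> = 0" using \<psi>[of \<one> \<one>] by simp
  have \<psi>inv: "\<psi> (inv y) = - \<psi> y" if "y \<in> H" for y using \<psi>[of "inv y" y] that \<psi>1 by simp
  have nat: "x [^] n \<in> H \<and> \<psi> (x [^] n) = int n * \<psi> x" for n :: nat
  proof (induction n)
    case 0
    then show ?case by (simp add: \<psi>1)
  next
    case (Suc n)
    then show ?case using \<psi>[of "x [^] n" x] x by (simp add: distrib_right)
  qed
  have xG: "x \<in> carrier G" using x by simp
  have "x [^] k \<in> H \<and> \<psi> (x [^] k) = k * \<psi> x"
  proof (cases k rule: int_cases2)
    case (nonneg n)
    then show ?thesis using nat[of n] by (simp only: int_pow_int)
  next
    case (nonpos n)
    have "x [^] k = inv (x [^] n)" unfolding nonpos by (rule int_pow_neg_int[OF xG])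
    then show ?thesis using nat[of n] \<psi>inv[of "x [^] n"] nonpos by auto
  qed
  then show "x [^] k \<in> H" "\<psi> (x [^] k) = k * \<psi> x" by auto
qed

text \<open>The image of \<open>H\<close> is a nonzero subgroup of the integers; its least positive
  element divides all others, by division with remainder.\<close>

lemma (in group) additive_image_generator:
  fixes \<psi> :: "'a \<Rightarrow> int"
  assumes H: "subgroup H G" and \<psi>: "\<And>x y. \<lbrakk>x \<in> H; y \<in> H\<rbrakk> \<Longrightarrow> \<psi> (x \<otimes> y) = \<psi> x + \<psi> y"
    and u: "u \<in> H" "\<psi> u > 0"
  obtains n :: nat and v where "0 < n" "v \<in> H" "\<psi> v = int n" "\<And>x. x \<in> H \<Longrightarrow> int n dvd \<psi> x"
proof -
  let ?P = "\<lambda>n::nat. 0 < n \<and> (\<exists>v\<in>H. \<psi> v = int n)"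
  define n where "n = (LEAST n. ?P n)"
  have "?P (nat (\<psi> u))" using u by auto
  then have "?P n" unfolding n_def by (rule LeastI)
  then obtain v where v: "0 < n" "v \<in> H" "\<psi> v = int n" by blast
  have "int n dvd \<psi> x" if x: "x \<in> H" for x
  proof -
    \<comment> \<open>Dividing off a power of \<open>v\<close> leaves the remainder modulo
      \<open>n\<close>, which the minimality of \<open>n\<close> forces to be 0.\<close>
    let ?y = "x \<otimes> v [^] (- (\<psi> x div int n))"
    note pw = additive_int_pow[OF H \<psi> v(2), of "- (\<psi> x div int n)"]
    have y: "?y \<in> H" "\<psi> ?y = \<psi> x mod int n"
      using \<psi>[OF x pw(1)] pw subgroup.m_closed[OF H x] v(3)
      by (simp_all add: minus_div_mult_eq_mod[symmetric])
    have "nat (\<psi> x mod int n) < n" using v(1) by (simp add: nat_less_iff)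
    then have "\<not> ?P (nat (\<psi> x mod int n))" unfolding n_def by (rule not_less_Least)
    then have "\<not> 0 < \<psi> x mod int n" using y by auto
    moreover have "0 \<le> \<psi> x mod int n" using v(1) by simp
    ultimately show ?thesis by (simp add: dvd_eq_mod_eq_0)
  qed
  then show ?thesis using that v by blast
qed

lemma (in group) int_pow_commute:
  fixes k :: int
  assumes "x \<in> carrier G" "y \<in> carrier G" "x \<otimes> y = y \<otimes> x"
  shows "x [^] k \<otimes> y = y \<otimes> x [^] k"
proof -
  have nat: "x [^] n \<otimes> y = y \<otimes> x [^] n" for n :: nat
    by (rule group_commutes_pow[OF assms(3,1,2)])
  have inv: "inv z \<otimes> y = y \<otimes> inv z" if z: "z \<in> carrier G" "z \<otimes> y = y \<otimes> z" for z
  proof -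
    have "y = inv z \<otimes> y \<otimes> z" using z assms(2) by (simp add: m_assoc flip: z(2)) (simp add: m_assoc[symmetric])
    then have "y \<otimes> inv z = inv z \<otimes> y \<otimes> z \<otimes> inv z" by simp
    then show ?thesis using z(1) assms(2) by (simp add: m_assoc)
  qed
  show ?thesis
  proof (cases k rule: int_cases2)
    case (nonneg n)
    then show ?thesis using nat[of n] by (simp only: int_pow_int)
  next
    case (nonpos n)
    have "x [^] k = inv (x [^] n)" unfolding nonpos by (rule int_pow_neg_int[OF assms(1)])
    then show ?thesis using inv[OF _ nat[of n]] assms(1) by simp
  qed
qed

text \<open>One step of collecting a word in two commuting elements into the form
  \<open>x [^] i \<otimes> y [^] j\<close>: \<open>P\<close> tells which of the two the next letter
  comes from.\<close>

lemma (in group) commuting_powers_mult: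
  fixes e i j :: int
  assumes x: "x \<in> carrier G" and y: "y \<in> carrier G" and xy: "x \<otimes> y = y \<otimes> x"
  shows "(if P then x else y) [^] e \<otimes> (x [^] i \<otimes> y [^] j) =
    x [^] (if P then e + i else i) \<otimes> y [^] (if P then j else e + j)"
proof (cases P)
  case True
  then show ?thesis using x y by (simp add: int_pow_mult m_assoc)
next
  case False
  have "y [^] e \<otimes> x [^] i = x [^] i \<otimes> y [^] e"
    by (rule int_pow_commute[OF y _ int_pow_commute[OF x y xy, symmetric]]) (use x in simp)
  then show ?thesis using False x y by (simp add: int_pow_mult m_assoc[symmetric])
qed

section \<open>The core of a subgroup of finite index\<close>

text \<open>\<open>N\<close> is the kernel of right multiplication acting on the finite set of right
  cosets. It is contained in \<open>H\<close> because \<open>H\<close> is itself a coset, fixed by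
  \<open>N\<close>; every element has a positive power in it because a finite set is
  permuted.\<close>

lemma (in group) finite_index_core:
  assumes H: "subgroup H G" and fin: "finite (rcosets H)"
  obtains N where "N \<lhd> G" "N \<subseteq> H" "\<And>x. x \<in> carrier G \<Longrightarrow> \<exists>p>0. x [^] (p::nat) \<in> N"
proof -
  define N where "N = {g \<in> carrier G. \<forall>C\<in>rcosets H. C #> g = C}"
  have HG: "H \<subseteq> carrier G" by (rule subgroup.subset[OF H])
  have CG: "C \<subseteq> carrier G" if "C \<in> rcosets H" for C
    using rcosets_part_G[OF H] that by blast
  have Cg: "C #> g \<in> rcosets H" if C: "C \<in> rcosets H" and g: "g \<in> carrier G" for C g
  proof -
    obtain a where "a \<in> carrier G" "C = H #> a" using C by (auto simp: RCOSETS_def)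
    then show ?thesis using g HG by (simp add: coset_mult_assoc rcosetsI)
  qed
  have assoc: "C #> (a \<otimes> b) = C #> a #> b" if "C \<in> rcosets H" "a \<in> carrier G" "b \<in> carrier G" for C a b
    using coset_mult_assoc[OF CG that(2,3)] that(1) by simp
  have inv: "C #> inv g = D" if "C \<in> rcosets H" "D \<in> rcosets H" "g \<in> carrier G" "D #> g = C" for C D g
    using assoc[OF that(2,3), of "inv g"] that CG[OF that(2)] by simp
  have "subgroup N G"
  proof (rule subgroupI)
    have "\<one> \<in> N" using CG by (simp add: N_def)
    then show "N \<noteq> {}" by blast
  qed (auto simp: N_def assoc inv)
  moreover have "x \<otimes> g \<otimes> inv x \<in> N" if x: "x \<in> carrier G" and g: "g \<in> N" for x g
  proof -
    have "C #> (x \<otimes> g \<otimes> inv x) = C" if C: "C \<in> rcosets H" for C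
      using x g C inv[OF Cg[OF C x] C x] by (simp add: N_def assoc Cg)
    then show ?thesis using x g by (simp add: N_def)
  qed
  ultimately have "N \<lhd> G" by (simp add: normal_inv_iff)
  moreover have "N \<subseteq> H"
  proof
    fix g assume "g \<in> N"
    then have "g \<in> carrier G" "H #> g = H"
      using rcosetsI[OF HG one_closed] HG by (auto simp: N_def)
    then show "g \<in> H" using coset_join1 H HG by blast
  qed
  moreover have "\<exists>p>0. x [^] (p::nat) \<in> N" if x: "x \<in> carrier G" for x
  proof -
    \<comment> \<open>Pigeonhole: as extensional functions on the cosets, the translations by powers
      of \<open>x\<close> form a finite set, so two exponents \<open>i < j\<close> act
      alike.\<close>
    let ?f = "\<lambda>i::nat. \<lambda>C\<in>rcosets H. C #> x [^] i"
    have "range ?f \<subseteq> rcosets H \<rightarrow>\<^sub>E rcosets H" using Cg x by auto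
    then have "finite (range ?f)" using finite_PiE[OF fin fin] finite_subset by blast
    then have "\<not> inj ?f" using finite_imageD infinite_UNIV_nat by blast
    then obtain i j where ij: "i < j" "?f i = ?f j"
      unfolding inj_on_def by (metis linorder_neq_iff)
    have "C #> x [^] (j - i) = C" if C: "C \<in> rcosets H" for C
    proof -
      \<comment> \<open>The coset to compare on is \<open>C\<close> moved back by
        \<open>x [^] i\<close>: the exponents \<open>i\<close> and \<open>j\<close> send it to
        \<open>C\<close> and to \<open>C #> x [^] (j - i)\<close>.\<close>
      let ?D = "C #> inv (x [^] i)"
      have D: "?D \<in> rcosets H" using Cg C x by simp
      have "C = ?D #> x [^] i"
        using assoc[OF C, of "inv (x [^] i)" "x [^] i"] x CG[OF C] by simp
      also have "\<dots> = ?D #> x [^] j" using fun_cong[OF ij(2), of ?D] D by simp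
      also have "\<dots> = ?D #> x [^] i #> x [^] (j - i)"
        using assoc[OF D, of "x [^] i" "x [^] (j - i)"] x ij(1) by (simp add: nat_pow_mult)
      also have "?D #> x [^] i = C"
        using assoc[OF C, of "inv (x [^] i)" "x [^] i"] x CG[OF C] by simp
      finally show ?thesis by simp
    qed
    then have "x [^] (j - i) \<in> N" using x by (simp add: N_def)
    then show ?thesis using ij(1) by (intro exI[of _ "j - i"]) simp
  qed
  ultimately show ?thesis using that by blast
qed

section \<open>Strongly graded rings\<close>

text \<open>The identity component itself takes the place of \<open>R\<close>: its isomorphism with
  \<open>R\<close> is recorded as membership of the unit of \<open>S\<close> in that
  component.\<close>

locale strong_grading = \<Gamma>?: group \<Gamma> + S?: ring S
  for \<Gamma> :: "('g, 'k) monoid_scheme" (structure) and S :: "('s, 'n) ring_scheme" (structure) +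
  fixes A :: "'g \<Rightarrow> 's set"
  assumes component_subgroup: "\<gamma> \<in> carrier \<Gamma> \<Longrightarrow> additive_subgroup (A \<gamma>) S"
    and family_sum_bij:
      "bij_betw (family_sum S) (homogeneous_families S A (carrier \<Gamma>)) (carrier S)"
    and component_mult: "\<lbrakk>\<gamma> \<in> carrier \<Gamma>; \<tau> \<in> carrier \<Gamma>\<rbrakk> \<Longrightarrow>
      generate (add_monoid S) (A \<gamma> <#>\<^bsub>S\<^esub> A \<tau>) = A (\<gamma> \<otimes>\<^bsub>\<Gamma>\<^esub> \<tau>)"
    and one_component: "\<one>\<^bsub>S\<^esub> \<in> A \<one>\<^bsub>\<Gamma>\<^esub>"

text \<open>A ring isomorphism sends the unit of \<open>R\<close> to the unit of its target, which
  is the unit of \<open>S\<close>.\<close>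

lemma strong_gradingI:
  assumes "group \<Gamma>" "ring R" "strongly_graded_ring \<Gamma> R S A"
  shows "strong_grading \<Gamma> S A"
proof -
  obtain h where "h \<in> ring_iso R (S\<lparr>carrier := A \<one>\<^bsub>\<Gamma>\<^esub>\<rparr>)"
    using assms(3) by (auto simp: strongly_graded_ring_def is_ring_iso_def)
  then have h: "h \<one>\<^bsub>R\<^esub> \<in> A \<one>\<^bsub>\<Gamma>\<^esub>" "h \<one>\<^bsub>R\<^esub> = \<one>\<^bsub>S\<^esub>"
    using ring.ring_simprules(6)[OF assms(2)] by (auto simp: ring_iso_def ring_hom_def Pi_def)
  then have "\<one>\<^bsub>S\<^esub> \<in> A \<one>\<^bsub>\<Gamma>\<^esub>" by metis
  then show ?thesis
    using assms by (auto simp: strong_grading_def strong_grading_axioms_def strongly_graded_ring_def)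
qed

context strong_grading
begin

section \<open>Homogeneous components and induction over their products\<close>

lemma component_closed: "\<lbrakk>\<gamma> \<in> carrier \<Gamma>; x \<in> A \<gamma>\<rbrakk> \<Longrightarrow> x \<in> carrier S"
  using additive_subgroup.a_Hcarr[OF component_subgroup] by blast

lemma component_zero: "\<gamma> \<in> carrier \<Gamma> \<Longrightarrow> \<zero>\<^bsub>S\<^esub> \<in> A \<gamma>"
  using additive_subgroup.zero_closed[OF component_subgroup] by blast

lemma component_add: "\<lbrakk>\<gamma> \<in> carrier \<Gamma>; x \<in> A \<gamma>; y \<in> A \<gamma>\<rbrakk> \<Longrightarrow> x \<oplus>\<^bsub>S\<^esub> y \<in> A \<gamma>"
  using additive_subgroup.a_closed[OF component_subgroup] by blast

lemma component_minus: "\<lbrakk>\<gamma> \<in> carrier \<Gamma>; x \<in> A \<gamma>\<rbrakk> \<Longrightarrow> \<ominus>\<^bsub>S\<^esub> x \<in> A \<gamma>"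
  using additive_subgroup.a_inv_closed[OF component_subgroup] S.abelian_group_axioms by blast

lemma component_times:
  "\<lbrakk>\<gamma> \<in> carrier \<Gamma>; \<tau> \<in> carrier \<Gamma>; x \<in> A \<gamma>; y \<in> A \<tau>\<rbrakk> \<Longrightarrow> x \<otimes>\<^bsub>S\<^esub> y \<in> A (\<gamma> \<otimes>\<^bsub>\<Gamma>\<^esub> \<tau>)"
  using generate.incl[of "x \<otimes>\<^bsub>S\<^esub> y" "A \<gamma> <#>\<^bsub>S\<^esub> A \<tau>" "add_monoid S"] component_mult
  by (auto simp: set_mult_def)

lemma component_int_mult:
  fixes k :: int
  assumes "\<gamma> \<in> carrier \<Gamma>" "x \<in> A \<gamma>"
  shows "[k] \<cdot>\<^bsub>S\<^esub> x \<in> A \<gamma>"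
proof -
  have nat: "[j] \<cdot>\<^bsub>S\<^esub> x \<in> A \<gamma>" for j :: nat
    by (induction j) (auto intro: component_zero component_add assms)
  show ?thesis
    using component_minus[OF assms(1)] nat
    by (cases "k \<ge> 0") (auto simp: add_pow_int_ge add_pow_int_lt)
qed

text \<open>\<open>A (\<gamma> \<otimes> \<tau>)\<close> is the additive group generated by the
  products. Zero and negatives of products are again products, so only the cases of products and
  sums remain. This replaces choosing a decomposition of an element.\<close>

lemma component_product_induct [consumes 3, case_names mult add]:
  assumes \<gamma>: "\<gamma> \<in> carrier \<Gamma>" and \<tau>: "\<tau> \<in> carrier \<Gamma>" and z: "z \<in> A (\<gamma> \<otimes>\<^bsub>\<Gamma>\<^esub> \<tau>)"
    and mult: "\<And>x y. \<lbrakk>x \<in> A \<gamma>; y \<in> A \<tau>\<rbrakk> \<Longrightarrow> P (x \<otimes>\<^bsub>S\<^esub> y)"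
    and add: "\<And>x y. \<lbrakk>x \<in> carrier S; y \<in> carrier S; P x; P y\<rbrakk> \<Longrightarrow> P (x \<oplus>\<^bsub>S\<^esub> y)"
  shows "P z"
proof -
  have "z \<in> generate (add_monoid S) (A \<gamma> <#>\<^bsub>S\<^esub> A \<tau>)" using z component_mult[OF \<gamma> \<tau>] by simp
  then have "z \<in> carrier S \<and> P z"
  proof (induction rule: generate.induct)
    case one
    show ?case
      using mult[OF component_zero[OF \<gamma>] component_zero[OF \<tau>]] by simp
  next
    case (incl h)
    then show ?case
      using mult component_closed[OF \<gamma>] component_closed[OF \<tau>] by (auto simp: set_mult_def)
  next
    case (inv h)
    then obtain x y where xy: "x \<in> A \<gamma>" "y \<in> A \<tau>" "h = x \<otimes>\<^bsub>S\<^esub> y" by (auto simp: set_mult_def)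
    have xyS: "x \<in> carrier S" "y \<in> carrier S"
      using xy component_closed[OF \<gamma>] component_closed[OF \<tau>] by auto
    have "inv\<^bsub>add_monoid S\<^esub> h = (\<ominus>\<^bsub>S\<^esub> x) \<otimes>\<^bsub>S\<^esub> y"
      using xyS by (simp add: xy(3) S.l_minus flip: a_inv_def)
    then show ?case
      using mult[OF component_minus[OF \<gamma> xy(1)] xy(2)] xyS by simp
  next
    case (eng h1 h2)
    then show ?case using add by simp
  qed
  then show ?thesis ..
qed

section \<open>Homogeneous families and their sums\<close>

lemma homogeneous_families_closed:
  assumes "f \<in> homogeneous_families S A U" and "U \<subseteq> carrier \<Gamma>"
  shows "f \<gamma> \<in> carrier S"
proof (cases "\<gamma> \<in> U")
  case True
  then have "\<gamma> \<in> carrier \<Gamma>" "f \<gamma> \<in> A \<gamma>" using assms by (auto simp: homogeneous_families_def)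
  then show ?thesis by (rule component_closed)
next
  case False
  then show ?thesis using assms(1) by (simp add: homogeneous_families_def)
qed

lemma homogeneous_families_finsum_eq:
  assumes f: "f \<in> homogeneous_families S A U" and U: "U \<subseteq> carrier \<Gamma>"
    and F: "finite F" "{\<gamma>. f \<gamma> \<noteq> \<zero>\<^bsub>S\<^esub>} \<subseteq> F"
  shows "family_sum S f = finsum S f F"
  unfolding family_sum_def
proof (rule S.add.finprod_mono_neutral_cong_left[OF F])
  show "f \<in> F \<rightarrow> carrier S"
    using homogeneous_families_closed[OF f U] by blast
qed auto

lemma family_sum_add:
  assumes f: "f \<in> homogeneous_families S A U" and g: "g \<in> homogeneous_families S A U"
    and U: "U \<subseteq> carrier \<Gamma>"
  shows "(\<lambda>\<gamma>. f \<gamma> \<oplus>\<^bsub>S\<^esub> g \<gamma>) \<in> homogeneous_families S A U"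
    and "family_sum S (\<lambda>\<gamma>. f \<gamma> \<oplus>\<^bsub>S\<^esub> g \<gamma>) = family_sum S f \<oplus>\<^bsub>S\<^esub> family_sum S g"
proof -
  let ?F = "{\<gamma>. f \<gamma> \<noteq> \<zero>\<^bsub>S\<^esub>} \<union> {\<gamma>. g \<gamma> \<noteq> \<zero>\<^bsub>S\<^esub>}"
  have F: "finite ?F" using f g by (simp add: homogeneous_families_def)
  have sub: "{\<gamma>. f \<gamma> \<oplus>\<^bsub>S\<^esub> g \<gamma> \<noteq> \<zero>\<^bsub>S\<^esub>} \<subseteq> ?F" by auto
  show fg: "(\<lambda>\<gamma>. f \<gamma> \<oplus>\<^bsub>S\<^esub> g \<gamma>) \<in> homogeneous_families S A U"
    using f g U finite_subset[OF sub F]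
    by (auto simp: homogeneous_families_def intro!: component_add)
  have car: "f \<gamma> \<in> carrier S" "g \<gamma> \<in> carrier S" for \<gamma>
    using homogeneous_families_closed f g U by auto
  have "family_sum S (\<lambda>\<gamma>. f \<gamma> \<oplus>\<^bsub>S\<^esub> g \<gamma>) = finsum S (\<lambda>\<gamma>. f \<gamma> \<oplus>\<^bsub>S\<^esub> g \<gamma>) ?F"
    by (rule homogeneous_families_finsum_eq[OF fg U F sub])
  also have "\<dots> = finsum S f ?F \<oplus>\<^bsub>S\<^esub> finsum S g ?F"
    using car by (intro S.finsum_addf) auto
  also have "finsum S f ?F = family_sum S f"
    by (rule homogeneous_families_finsum_eq[OF f U F, symmetric]) auto
  also have "finsum S g ?F = family_sum S g"
    by (rule homogeneous_families_finsum_eq[OF g U F, symmetric]) auto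
  finally show "family_sum S (\<lambda>\<gamma>. f \<gamma> \<oplus>\<^bsub>S\<^esub> g \<gamma>) = family_sum S f \<oplus>\<^bsub>S\<^esub> family_sum S g" .
qed

lemma single_family:
  assumes "\<gamma> \<in> U" "U \<subseteq> carrier \<Gamma>" "x \<in> A \<gamma>"
  shows "(\<lambda>\<tau>. if \<tau> = \<gamma> then x else \<zero>\<^bsub>S\<^esub>) \<in> homogeneous_families S A U"
    and "family_sum S (\<lambda>\<tau>. if \<tau> = \<gamma> then x else \<zero>\<^bsub>S\<^esub>) = x"
proof -
  have fin: "finite {\<gamma>}" and sub: "{\<tau>. (if \<tau> = \<gamma> then x else \<zero>\<^bsub>S\<^esub>) \<noteq> \<zero>\<^bsub>S\<^esub>} \<subseteq> {\<gamma>}" by auto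
  show f: "(\<lambda>\<tau>. if \<tau> = \<gamma> then x else \<zero>\<^bsub>S\<^esub>) \<in> homogeneous_families S A U"
    using assms finite_subset[OF sub fin]
    by (auto simp: homogeneous_families_def intro: component_zero)
  have "x \<in> carrier S" using assms component_closed by blast
  then show "family_sum S (\<lambda>\<tau>. if \<tau> = \<gamma> then x else \<zero>\<^bsub>S\<^esub>) = x"
    using homogeneous_families_finsum_eq[OF f assms(2) fin sub] by simp
qed

section \<open>The subrings spanned by sets of degrees\<close>

text \<open>The underlying set of R(U), also for a set \<open>U\<close> of degrees that is not a
  subgroup.\<close>

abbreviation homog_span :: "'g set \<Rightarrow> 's set"
  where "homog_span U \<equiv> carrier (graded_subring S A U)"

lemma graded_subring_simps [simp]:
  "\<zero>\<^bsub>graded_subring S A U\<^esub> = \<zero>\<^bsub>S\<^esub>" "\<one>\<^bsub>graded_subring S A U\<^esub> = \<one>\<^bsub>S\<^esub>"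
  "x \<oplus>\<^bsub>graded_subring S A U\<^esub> y = x \<oplus>\<^bsub>S\<^esub> y" "x \<otimes>\<^bsub>graded_subring S A U\<^esub> y = x \<otimes>\<^bsub>S\<^esub> y"
  by (simp_all add: graded_subring_def)

lemma homog_span_def: "homog_span U = family_sum S ` homogeneous_families S A U"
  by (simp add: graded_subring_def)

lemma homog_span_component:
  assumes "U \<subseteq> carrier \<Gamma>" "\<gamma> \<in> U" "x \<in> A \<gamma>"
  shows "x \<in> homog_span U"
  using single_family[OF assms(2,1,3)] unfolding homog_span_def by (metis imageI)

lemma homog_span_add:
  assumes "U \<subseteq> carrier \<Gamma>" "x \<in> homog_span U" "y \<in> homog_span U"
  shows "x \<oplus>\<^bsub>S\<^esub> y \<in> homog_span U"
proof -
  obtain f g where f: "f \<in> homogeneous_families S A U" "x = family_sum S f"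
    and g: "g \<in> homogeneous_families S A U" "y = family_sum S g"
    using assms(2,3) unfolding homog_span_def by blast
  show ?thesis
    unfolding homog_span_def using family_sum_add[OF f(1) g(1) assms(1)] f(2) g(2) by (intro image_eqI) auto
qed

lemma homog_span_zero:
  assumes "U \<subseteq> carrier \<Gamma>"
  shows "\<zero>\<^bsub>S\<^esub> \<in> homog_span U"
proof -
  have "(\<lambda>_. \<zero>\<^bsub>S\<^esub>) \<in> homogeneous_families S A U"
    using assms by (auto simp: homogeneous_families_def intro: component_zero)
  moreover have "family_sum S (\<lambda>_. \<zero>\<^bsub>S\<^esub>) = \<zero>\<^bsub>S\<^esub>" by (simp add: family_sum_def)
  ultimately show ?thesis unfolding homog_span_def by (metis imageI)
qed

lemma homog_span_carrier: "homog_span (carrier \<Gamma>) = carrier S"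
  using family_sum_bij by (simp add: homog_span_def bij_betw_def)

lemma homog_span_mono:
  assumes "U \<subseteq> V" "V \<subseteq> carrier \<Gamma>"
  shows "homog_span U \<subseteq> homog_span V"
proof -
  have "f \<in> homogeneous_families S A V" if f: "f \<in> homogeneous_families S A U" for f
  proof -
    have "f \<gamma> \<in> A \<gamma>" if "\<gamma> \<in> V" for \<gamma>
    proof (cases "\<gamma> \<in> U")
      case True
      then show ?thesis using f by (simp add: homogeneous_families_def)
    next
      case False
      then have "f \<gamma> = \<zero>\<^bsub>S\<^esub>" using f by (simp add: homogeneous_families_def)
      then show ?thesis using component_zero that assms(2) by auto
    qed
    then show ?thesis using f assms(1) by (auto simp: homogeneous_families_def)
  qed
  then show ?thesis by (auto simp: homog_span_def)
qed

lemma homog_span_closed: "\<lbrakk>U \<subseteq> carrier \<Gamma>; x \<in> homog_span U\<rbrakk> \<Longrightarrow> x \<in> carrier S"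
  using homog_span_mono[of U "carrier \<Gamma>"] homog_span_carrier by blast

text \<open>Every element is a finite sum of homogeneous ones. Membership in the span is proved
  along with \<open>P\<close> for the partial sums, since the \<open>add\<close> case supplies it
  for both summands.\<close>

lemma homog_span_induct [consumes 2, case_names zero component add]:
  assumes U: "U \<subseteq> carrier \<Gamma>" and x: "x \<in> homog_span U"
    and zero: "P \<zero>\<^bsub>S\<^esub>"
    and comp: "\<And>\<gamma> x. \<lbrakk>\<gamma> \<in> U; x \<in> A \<gamma>\<rbrakk> \<Longrightarrow> P x"
    and add: "\<And>x y. \<lbrakk>x \<in> homog_span U; y \<in> homog_span U; P x; P y\<rbrakk> \<Longrightarrow> P (x \<oplus>\<^bsub>S\<^esub> y)"
  shows "P x"
proof -
  obtain f where f: "f \<in> homogeneous_families S A U" and xf: "x = family_sum S f"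
    using x by (auto simp: homog_span_def)
  have fA: "f \<gamma> \<in> A \<gamma>" if "\<gamma> \<in> U" for \<gamma> using f that by (auto simp: homogeneous_families_def)
  have "finsum S f F \<in> homog_span U \<and> P (finsum S f F)" if "finite F" "F \<subseteq> U" for F
    using that
  proof (induction F rule: finite_induct)
    case empty
    then show ?case using zero homog_span_zero[OF U] by simp
  next
    case (insert \<gamma> F)
    have "finsum S f (insert \<gamma> F) = f \<gamma> \<oplus>\<^bsub>S\<^esub> finsum S f F"
      using insert fA U component_closed by (intro S.finsum_insert) (auto simp: subset_iff)
    then show ?case
      using insert fA[of \<gamma>] comp[of \<gamma> "f \<gamma>"] add homog_span_add[OF U] homog_span_component[OF U, of \<gamma>] by auto
  qed
  moreover have "finite {\<gamma>. f \<gamma> \<noteq> \<zero>\<^bsub>S\<^esub>}" "{\<gamma>. f \<gamma> \<noteq> \<zero>\<^bsub>S\<^esub>} \<subseteq> U"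
    using f by (auto simp: homogeneous_families_def)
  ultimately show ?thesis by (simp add: xf family_sum_def)
qed

text \<open>Degrees multiply inside \<open>U\<close>; general products follow by additivity, first
  in the right factor (\<open>A_mult\<close>), then in the left one.\<close>

lemma homog_span_subring:
  assumes "subgroup U \<Gamma>"
  shows "subring (homog_span U) S"
proof -
  interpret U: subgroup U \<Gamma> by fact
  note Us = U.subset
  have A_mult: "x \<otimes>\<^bsub>S\<^esub> y \<in> homog_span U" if "\<gamma> \<in> U" "x \<in> A \<gamma>" "y \<in> homog_span U" for \<gamma> x y
    using Us that(3)
  proof (induction rule: homog_span_induct)
    case zero
    have "x \<otimes>\<^bsub>S\<^esub> \<zero>\<^bsub>S\<^esub> = \<zero>\<^bsub>S\<^esub>" using component_closed[of \<gamma> x] that by auto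
    then show ?case using homog_span_zero[OF Us] by simp
  next
    case (component \<tau> y)
    then show ?case
      using homog_span_component[OF Us U.m_closed[OF that(1) component(1)]]
        component_times[of \<gamma> \<tau> x y] that by auto
  next
    case (add y z)
    have "x \<otimes>\<^bsub>S\<^esub> (y \<oplus>\<^bsub>S\<^esub> z) = x \<otimes>\<^bsub>S\<^esub> y \<oplus>\<^bsub>S\<^esub> x \<otimes>\<^bsub>S\<^esub> z"
      using add homog_span_closed[OF Us] component_closed[of \<gamma> x] that by (simp add: S.r_distr)
    then show ?case using add homog_span_add[OF Us] by simp
  qed
  show ?thesis
  proof (rule S.subringI)
    show "homog_span U \<subseteq> carrier S" using homog_span_closed[OF Us] by blast
    show "\<one>\<^bsub>S\<^esub> \<in> homog_span U" by (rule homog_span_component[OF Us U.one_closed one_component])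
    show "x \<oplus>\<^bsub>S\<^esub> y \<in> homog_span U" if "x \<in> homog_span U" "y \<in> homog_span U" for x y
      by (rule homog_span_add[OF Us that])
    show "x \<otimes>\<^bsub>S\<^esub> y \<in> homog_span U" if "x \<in> homog_span U" "y \<in> homog_span U" for x y
      using Us that(1)
    proof (induction rule: homog_span_induct)
      case zero
      have "\<zero>\<^bsub>S\<^esub> \<otimes>\<^bsub>S\<^esub> y = \<zero>\<^bsub>S\<^esub>" using homog_span_closed[OF Us] that(2) by simp
      then show ?case using homog_span_zero[OF Us] by simp
    next
      case (component \<gamma> x)
      then show ?case using A_mult that(2) by blast
    next
      case (add x z)
      have "(x \<oplus>\<^bsub>S\<^esub> z) \<otimes>\<^bsub>S\<^esub> y = x \<otimes>\<^bsub>S\<^esub> y \<oplus>\<^bsub>S\<^esub> z \<otimes>\<^bsub>S\<^esub> y"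
        using add homog_span_closed[OF Us] that(2) by (simp add: S.l_distr)
      then show ?case using add homog_span_add[OF Us] by simp
    qed
    show "\<ominus>\<^bsub>S\<^esub> x \<in> homog_span U" if "x \<in> homog_span U" for x
      using Us that
    proof (induction rule: homog_span_induct)
      case zero
      then show ?case using homog_span_zero[OF Us] by simp
    next
      case (component \<gamma> x)
      then show ?case using homog_span_component[OF Us] component_minus Us by blast
    next
      case (add x z)
      then show ?case
        using homog_span_closed[OF Us] homog_span_add[OF Us] by (simp add: S.minus_add)
    qed
  qed
qed

lemma graded_subring_ring: "subgroup U \<Gamma> \<Longrightarrow> ring (graded_subring S A U)"
  using S.subring_is_ring[OF homog_span_subring] by (simp add: graded_subring_def)

section \<open>Derivations given by the degree\<close>

text \<open>\<open>the_inv_into\<close> recovers the homogeneous components of \<open>x\<close>, and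
  each is multiplied by the integer that \<kappa> assigns to its degree. For a homomorphism \<kappa>
  this is the Euler derivation of the grading.\<close>

definition degree_derivation :: "('g \<Rightarrow> int) \<Rightarrow> 's \<Rightarrow> 's"
  where "degree_derivation \<kappa> x = family_sum S (\<lambda>\<gamma>. [\<kappa> \<gamma>] \<cdot>\<^bsub>S\<^esub>
    the_inv_into (homogeneous_families S A (carrier \<Gamma>)) (family_sum S) x \<gamma>)"

lemma degree_derivation_family:
  assumes "f \<in> homogeneous_families S A (carrier \<Gamma>)"
  shows "(\<lambda>\<gamma>. [\<kappa> \<gamma>] \<cdot>\<^bsub>S\<^esub> f \<gamma>) \<in> homogeneous_families S A (carrier \<Gamma>)"
    and "degree_derivation \<kappa> (family_sum S f) = family_sum S (\<lambda>\<gamma>. [\<kappa> \<gamma>] \<cdot>\<^bsub>S\<^esub> f \<gamma>)"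
proof -
  have z: "[k] \<cdot>\<^bsub>S\<^esub> \<zero>\<^bsub>S\<^esub> = \<zero>\<^bsub>S\<^esub>" for k :: int
    by (rule S.add.int_pow_one)
  have "{\<gamma>. [\<kappa> \<gamma>] \<cdot>\<^bsub>S\<^esub> f \<gamma> \<noteq> \<zero>\<^bsub>S\<^esub>} \<subseteq> {\<gamma>. f \<gamma> \<noteq> \<zero>\<^bsub>S\<^esub>}" using z by auto
  then show "(\<lambda>\<gamma>. [\<kappa> \<gamma>] \<cdot>\<^bsub>S\<^esub> f \<gamma>) \<in> homogeneous_families S A (carrier \<Gamma>)"
    using assms z finite_subset
    by (auto simp: homogeneous_families_def intro: component_int_mult)
  show "degree_derivation \<kappa> (family_sum S f) = family_sum S (\<lambda>\<gamma>. [\<kappa> \<gamma>] \<cdot>\<^bsub>S\<^esub> f \<gamma>)"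
    using family_sum_bij assms
    by (simp add: degree_derivation_def the_inv_into_f_f bij_betw_def)
qed

lemma degree_derivation_component:
  assumes "\<gamma> \<in> carrier \<Gamma>" "x \<in> A \<gamma>"
  shows "degree_derivation \<kappa> x = [\<kappa> \<gamma>] \<cdot>\<^bsub>S\<^esub> x"
proof -
  let ?f = "\<lambda>y \<tau>. if \<tau> = \<gamma> then y else \<zero>\<^bsub>S\<^esub>"
  note f = single_family[OF assms(1) order.refl assms(2)]
  have "(\<lambda>\<tau>. [\<kappa> \<tau>] \<cdot>\<^bsub>S\<^esub> ?f x \<tau>) = ?f ([\<kappa> \<gamma>] \<cdot>\<^bsub>S\<^esub> x)"
    using S.add.int_pow_one by auto
  then have "degree_derivation \<kappa> x = family_sum S (?f ([\<kappa> \<gamma>] \<cdot>\<^bsub>S\<^esub> x))"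
    using degree_derivation_family(2)[OF f(1), of \<kappa>] f(2) by simp
  then show ?thesis
    using single_family(2)[OF assms(1) order.refl component_int_mult[OF assms]] by simp
qed

lemma degree_derivation_add:
  assumes "x \<in> carrier S" "y \<in> carrier S"
  shows "degree_derivation \<kappa> (x \<oplus>\<^bsub>S\<^esub> y) = degree_derivation \<kappa> x \<oplus>\<^bsub>S\<^esub> degree_derivation \<kappa> y"
proof -
  let ?H = "homogeneous_families S A (carrier \<Gamma>)"
  have "x \<in> family_sum S ` ?H" "y \<in> family_sum S ` ?H"
    using assms family_sum_bij by (simp_all add: bij_betw_def)
  then obtain f g where f: "f \<in> ?H" "x = family_sum S f" and g: "g \<in> ?H" "y = family_sum S g"
    by blast
  have car: "f \<gamma> \<in> carrier S" "g \<gamma> \<in> carrier S" for \<gamma>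
    using homogeneous_families_closed f(1) g(1) by auto
  have "degree_derivation \<kappa> (x \<oplus>\<^bsub>S\<^esub> y) = degree_derivation \<kappa> (family_sum S (\<lambda>\<gamma>. f \<gamma> \<oplus>\<^bsub>S\<^esub> g \<gamma>))"
    using family_sum_add(2)[OF f(1) g(1)] f g by simp
  also have "\<dots> = family_sum S (\<lambda>\<gamma>. [\<kappa> \<gamma>] \<cdot>\<^bsub>S\<^esub> (f \<gamma> \<oplus>\<^bsub>S\<^esub> g \<gamma>))"
    by (rule degree_derivation_family(2)[OF family_sum_add(1)[OF f(1) g(1) order.refl]])
  also have "\<dots> = family_sum S (\<lambda>\<gamma>. [\<kappa> \<gamma>] \<cdot>\<^bsub>S\<^esub> f \<gamma> \<oplus>\<^bsub>S\<^esub> [\<kappa> \<gamma>] \<cdot>\<^bsub>S\<^esub> g \<gamma>)"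
    using S.add.int_pow_distrib car by simp
  also have "\<dots> = degree_derivation \<kappa> x \<oplus>\<^bsub>S\<^esub> degree_derivation \<kappa> y"
    unfolding f(2) g(2) degree_derivation_family(2)[OF f(1)] degree_derivation_family(2)[OF g(1)]
    by (intro family_sum_add(2)[where U = "carrier \<Gamma>"] degree_derivation_family(1) f(1) g(1)) simp
  finally show ?thesis .
qed

lemma degree_derivation_zero: "degree_derivation \<kappa> \<zero>\<^bsub>S\<^esub> = \<zero>\<^bsub>S\<^esub>"
  using degree_derivation_component[OF \<Gamma>.one_closed component_zero[OF \<Gamma>.one_closed]]
    S.add.int_pow_one by simp

lemma degree_derivation_homog_span:
  assumes U: "U \<subseteq> carrier \<Gamma>" and x: "x \<in> homog_span U"
  shows "degree_derivation \<kappa> x \<in> homog_span U"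
  using U x
proof (induction rule: homog_span_induct)
  case zero
  show ?case using homog_span_zero[OF U] by (simp add: degree_derivation_zero)
next
  case (component \<gamma> x)
  then have "\<gamma> \<in> carrier \<Gamma>" using U by blast
  then show ?case
    using homog_span_component[OF U component(1) component_int_mult[OF _ component(2)]]
      degree_derivation_component[OF _ component(2)] by simp
next
  case (add x y)
  then show ?case using homog_span_closed[OF U] homog_span_add[OF U] degree_derivation_add by simp
qed

text \<open>On homogeneous elements with degrees in \<open>U\<close> the Leibniz rule is the
  additivity of \<kappa>; both sides are biadditive, which extends it.\<close>

lemma degree_derivation_mult:
  assumes U: "subgroup U \<Gamma>" and x: "x \<in> homog_span U" and y: "y \<in> homog_span U"
    and \<kappa>: "\<And>\<gamma> \<tau>. \<lbrakk>\<gamma> \<in> U; \<tau> \<in> U\<rbrakk> \<Longrightarrow> \<kappa> (\<gamma> \<otimes>\<^bsub>\<Gamma>\<^esub> \<tau>) = \<kappa> \<gamma> + \<kappa> \<tau>"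
  shows "degree_derivation \<kappa> (x \<otimes>\<^bsub>S\<^esub> y) =
    degree_derivation \<kappa> x \<otimes>\<^bsub>S\<^esub> y \<oplus>\<^bsub>S\<^esub> x \<otimes>\<^bsub>S\<^esub> degree_derivation \<kappa> y"
proof -
  interpret U: subgroup U \<Gamma> by fact
  let ?d = "degree_derivation \<kappa>"
  note UG = U.subset
  have dS: "?d z \<in> carrier S" if "z \<in> carrier S" for z
    using degree_derivation_homog_span[of "carrier \<Gamma>" z] that homog_span_carrier by simp
  note sc = homog_span_closed[OF UG]
  have homog: "?d (x \<otimes>\<^bsub>S\<^esub> y) = ?d x \<otimes>\<^bsub>S\<^esub> y \<oplus>\<^bsub>S\<^esub> x \<otimes>\<^bsub>S\<^esub> ?d y"
    if \<gamma>: "\<gamma> \<in> U" "x \<in> A \<gamma>" and y: "y \<in> homog_span U" for \<gamma> x y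
    using UG y
  proof (induction rule: homog_span_induct)
    case zero
    then show ?case using \<gamma> UG component_closed[of \<gamma> x] dS by (auto simp: degree_derivation_zero)
  next
    case (component \<tau> y)
    have G: "\<gamma> \<in> carrier \<Gamma>" "\<tau> \<in> carrier \<Gamma>" using \<gamma> component UG by auto
    have c: "x \<in> carrier S" "y \<in> carrier S" 
      using component_closed[OF G(1) \<gamma>(2)] component_closed[OF G(2) component(2)] by auto
    have "?d (x \<otimes>\<^bsub>S\<^esub> y) = [(\<kappa> \<gamma> + \<kappa> \<tau>)] \<cdot>\<^bsub>S\<^esub> (x \<otimes>\<^bsub>S\<^esub> y)"
      using degree_derivation_component[OF _ component_times[OF G \<gamma>(2) component(2)]] G
        \<kappa>[OF \<gamma>(1) component(1)] by simp
    also have "\<dots> = [\<kappa> \<gamma>] \<cdot>\<^bsub>S\<^esub> (x \<otimes>\<^bsub>S\<^esub> y) \<oplus>\<^bsub>S\<^esub> [\<kappa> \<tau>] \<cdot>\<^bsub>S\<^esub> (x \<otimes>\<^bsub>S\<^esub> y)"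
      using c by (intro S.add.int_pow_mult) simp
    also have "\<dots> = ?d x \<otimes>\<^bsub>S\<^esub> y \<oplus>\<^bsub>S\<^esub> x \<otimes>\<^bsub>S\<^esub> ?d y"
      using c degree_derivation_component[OF G(1) \<gamma>(2)]
        degree_derivation_component[OF G(2) component(2)]
      by (simp add: S.add_pow_ldistr_int S.add_pow_rdistr_int)
    finally show ?case .
  next
    case (add y z)
    have "x \<in> carrier S" using component_closed \<gamma> UG by blast
    then show ?case
      using add sc by (simp add: degree_derivation_add dS S.r_distr S.a_ac)
  qed
  show ?thesis
    using UG x
  proof (induction rule: homog_span_induct)
    case zero
    then show ?case using sc y dS by (simp add: degree_derivation_zero)
  next
    case (component \<gamma> x)
    then show ?case using homog y by blast
  next
    case (add x z)
    then show ?case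
      using sc y by (simp add: degree_derivation_add dS S.l_distr S.a_ac)
  qed
qed

end

section \<open>Modules over strongly graded rings\<close>

text \<open>Maps are built and compared as additive maps, with linearity stated degree by degree,
  since the intermediate maps are linear in some degrees only.\<close>

abbreviation additive_maps :: "('r, 'a) module \<Rightarrow> ('r, 'b) module \<Rightarrow> ('a \<Rightarrow> 'b) set"
  where "additive_maps M N \<equiv> hom (add_monoid M) (add_monoid N)"

lemma left_module_restrict:
  assumes M: "left_module (R\<lparr>carrier := C\<rparr>) M" and D: "ring (R\<lparr>carrier := D\<rparr>)" and "D \<subseteq> C"
  shows "left_module (R\<lparr>carrier := D\<rparr>) M"
proof -
  interpret M: left_module "R\<lparr>carrier := C\<rparr>" M by fact
  show ?thesis
    using assms(3) M.smult_l_distr M.smult_r_distr M.smult_assoc1 M.smult_one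
    by (intro left_module.intro[OF D] left_module_axioms.intro M.M.abelian_group_axioms)
      (auto simp: subset_iff)
qed

text \<open>Supplies the module in which differences of two lifts along \<open>g\<close> take their
  values.\<close>

lemma kernel_left_module:
  assumes "left_module R M" "left_module R N" "g \<in> linear_maps R M N"
  shows "left_module R (M\<lparr>carrier := {x \<in> carrier M. g x = \<zero>\<^bsub>N\<^esub>}\<rparr>)"
proof -
  interpret M: left_module R M by fact
  interpret N: left_module R N by fact
  have z: "g \<zero>\<^bsub>M\<^esub> = \<zero>\<^bsub>N\<^esub>" by (rule M.linear_maps_zero[OF assms(2,3)])
  have add: "g (x \<oplus>\<^bsub>M\<^esub> y) = g x \<oplus>\<^bsub>N\<^esub> g y" if "x \<in> carrier M" "y \<in> carrier M" for x y
    using assms(3) that by (auto simp: linear_maps_def)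
  have sm: "g (r \<odot>\<^bsub>M\<^esub> x) = r \<odot>\<^bsub>N\<^esub> g x" if "r \<in> carrier R" "x \<in> carrier M" for r x
    using assms(3) that by (auto simp: linear_maps_def)
  have neg: "g (\<ominus>\<^bsub>M\<^esub> x) = \<zero>\<^bsub>N\<^esub>" if "x \<in> carrier M" "g x = \<zero>\<^bsub>N\<^esub>" for x
  proof -
    have "g (\<ominus>\<^bsub>M\<^esub> x) \<in> carrier N" using assms(3) that by (auto simp: linear_maps_def)
    then show ?thesis using add[of "\<ominus>\<^bsub>M\<^esub> x" x] that z by (simp add: M.M.l_neg)
  qed
  have "abelian_group (M\<lparr>carrier := {x \<in> carrier M. g x = \<zero>\<^bsub>N\<^esub>}\<rparr>)"
  proof (rule abelian_groupI, goal_cases)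
    case (6 x)
    then show ?case using neg by (auto intro!: bexI[of _ "\<ominus>\<^bsub>M\<^esub> x"] simp: M.M.l_neg)
  qed (auto simp: z add M.M.a_ac)
  then show ?thesis
    by (intro left_module.intro left_module_axioms.intro M.R.ring_axioms)
      (auto simp: sm N.smult_r_null M.smult_l_distr M.smult_r_distr M.smult_assoc1)
qed

context strong_grading
begin

text \<open>
  The map \<open>w\<close> is the first component of a splitting of \<open>B \<times> M \<rightarrow> M\<close>, where \<open>x \<in> R(H)\<close> acts on \<open>B \<times> M\<close> by
  \<open>x (b, m) = (x b + c (\<delta>(x) m), x m)\<close> with the derivation \<open>\<delta>\<close> of \<open>R(H)\<close> that is multiplication by \<open>\<kappa> \<gamma>\<close> in degree \<open>\<gamma>\<close>.
\<close>

lemma twisted_splitting: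
  assumes H: "subgroup H \<Gamma>" and B: "left_module (graded_subring S A H) B"
    and proj: "projective_module (graded_subring S A H) M"
    and c: "c \<in> linear_maps (graded_subring S A H) M B"
    and \<kappa>: "\<And>\<gamma> \<tau>. \<lbrakk>\<gamma> \<in> H; \<tau> \<in> H\<rbrakk> \<Longrightarrow> \<kappa> (\<gamma> \<otimes>\<^bsub>\<Gamma>\<^esub> \<tau>) = \<kappa> \<gamma> + \<kappa> \<tau>"
  obtains w where "w \<in> additive_maps M B"
    and "\<And>x m. \<lbrakk>x \<in> homog_span H; m \<in> carrier M\<rbrakk> \<Longrightarrow>
      w (x \<odot>\<^bsub>M\<^esub> m) = x \<odot>\<^bsub>B\<^esub> w m \<oplus>\<^bsub>B\<^esub> c (degree_derivation \<kappa> x \<odot>\<^bsub>M\<^esub> m)"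
proof -
  let ?T = "graded_subring S A H" and ?d = "degree_derivation \<kappa>"
  interpret B: left_module ?T B by fact
  interpret M: left_module ?T M using proj by (simp add: projective_module_def)
  have HG: "H \<subseteq> carrier \<Gamma>" by (rule subgroup.subset[OF H])
  note Tc = homog_span_closed[OF HG]
  have dT: "?d x \<in> homog_span H" if "x \<in> homog_span H" for x
    by (rule degree_derivation_homog_span[OF HG that])
  have dadd: "?d (x \<oplus>\<^bsub>S\<^esub> y) = ?d x \<oplus>\<^bsub>S\<^esub> ?d y" if "x \<in> homog_span H" "y \<in> homog_span H" for x y
    using degree_derivation_add Tc that by blast
  have dmult: "?d (x \<otimes>\<^bsub>S\<^esub> y) = ?d x \<otimes>\<^bsub>S\<^esub> y \<oplus>\<^bsub>S\<^esub> x \<otimes>\<^bsub>S\<^esub> ?d y"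
    if "x \<in> homog_span H" "y \<in> homog_span H" for x y
    by (rule degree_derivation_mult[OF H that \<kappa>])
  \<comment> \<open>The derivation kills the unit; this gives the unit law of the twisted
    action.\<close>
  have d1: "?d \<one>\<^bsub>S\<^esub> = \<zero>\<^bsub>S\<^esub>"
  proof -
    have "\<kappa> \<one>\<^bsub>\<Gamma>\<^esub> = 0" using \<kappa>[of "\<one>\<^bsub>\<Gamma>\<^esub>" "\<one>\<^bsub>\<Gamma>\<^esub>"] subgroup.one_closed[OF H] by simp
    then show ?thesis using degree_derivation_component[OF \<Gamma>.one_closed one_component]
      by (simp add: add_pow_int_ge)
  qed
  have cB: "c m \<in> carrier B" if "m \<in> carrier M" for m
    using c that by (auto simp: linear_maps_def)
  have cadd: "c (m \<oplus>\<^bsub>M\<^esub> m') = c m \<oplus>\<^bsub>B\<^esub> c m'" if "m \<in> carrier M" "m' \<in> carrier M" for m m'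
    using c that by (auto simp: linear_maps_def)
  have csm: "c (x \<odot>\<^bsub>M\<^esub> m) = x \<odot>\<^bsub>B\<^esub> c m" if "x \<in> homog_span H" "m \<in> carrier M" for x m
    using c that by (auto simp: linear_maps_def)
  have c0: "c \<zero>\<^bsub>M\<^esub> = \<zero>\<^bsub>B\<^esub>" by (rule M.linear_maps_zero[OF B c])
  let ?E = "\<lparr>carrier = carrier B \<times> carrier M,
    monoid.mult = undefined, one = undefined,
    ring.zero = (\<zero>\<^bsub>B\<^esub>, \<zero>\<^bsub>M\<^esub>), add = (\<lambda>p q. (fst p \<oplus>\<^bsub>B\<^esub> fst q, snd p \<oplus>\<^bsub>M\<^esub> snd q)),
    smult = (\<lambda>x p. (x \<odot>\<^bsub>B\<^esub> fst p \<oplus>\<^bsub>B\<^esub> c (?d x \<odot>\<^bsub>M\<^esub> snd p), x \<odot>\<^bsub>M\<^esub> snd p))\<rparr>"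
  have "abelian_group ?E"
  proof (rule abelian_groupI, goal_cases)
    case (6 p)
    then show ?case
      by (intro bexI[of _ "(\<ominus>\<^bsub>B\<^esub> fst p, \<ominus>\<^bsub>M\<^esub> snd p)"]) (auto simp: B.M.l_neg M.M.l_neg)
  qed (auto simp: B.M.a_ac M.M.a_ac)
  then have E: "left_module ?T ?E"
  proof (intro left_module.intro left_module_axioms.intro B.R.ring_axioms, goal_cases)
    case (2 x p)
    then show ?case using dT cB by auto
  next
    case (3 x y p)
    then have p: "fst p \<in> carrier B" "snd p \<in> carrier M" by auto
    have "(x \<oplus>\<^bsub>S\<^esub> y) \<odot>\<^bsub>B\<^esub> fst p = x \<odot>\<^bsub>B\<^esub> fst p \<oplus>\<^bsub>B\<^esub> y \<odot>\<^bsub>B\<^esub> fst p"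
      using B.smult_l_distr[of x y "fst p"] 3 p by simp
    moreover have "(x \<oplus>\<^bsub>S\<^esub> y) \<odot>\<^bsub>M\<^esub> snd p = x \<odot>\<^bsub>M\<^esub> snd p \<oplus>\<^bsub>M\<^esub> y \<odot>\<^bsub>M\<^esub> snd p"
      using M.smult_l_distr[of x y "snd p"] 3 p by simp
    moreover have "(?d x \<oplus>\<^bsub>S\<^esub> ?d y) \<odot>\<^bsub>M\<^esub> snd p = ?d x \<odot>\<^bsub>M\<^esub> snd p \<oplus>\<^bsub>M\<^esub> ?d y \<odot>\<^bsub>M\<^esub> snd p"
      using M.smult_l_distr[of "?d x" "?d y" "snd p"] 3 dT p by simp
    ultimately show ?case
      using 3 p dT cB by (simp add: dadd cadd B.M.a_ac)
  next
    case (4 x p q)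
    then have p: "fst p \<in> carrier B" "snd p \<in> carrier M" "fst q \<in> carrier B" "snd q \<in> carrier M"
      by auto
    then show ?case
      using 4 dT cB by (simp add: B.smult_r_distr M.smult_r_distr cadd B.M.a_ac)
  next
    case (5 x y p)
    then have p: "fst p \<in> carrier B" "snd p \<in> carrier M" by auto
    note xy = 5(2,3)
    have "(x \<otimes>\<^bsub>S\<^esub> y) \<odot>\<^bsub>B\<^esub> fst p = x \<odot>\<^bsub>B\<^esub> (y \<odot>\<^bsub>B\<^esub> fst p)"
      using B.smult_assoc1[OF xy p(1)] by simp
    moreover have "(x \<otimes>\<^bsub>S\<^esub> y) \<odot>\<^bsub>M\<^esub> snd p = x \<odot>\<^bsub>M\<^esub> (y \<odot>\<^bsub>M\<^esub> snd p)"
      using M.smult_assoc1[OF xy p(2)] by simp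
    \<comment> \<open>Associativity of the twisted action: the Leibniz rule splits the argument, and
      linearity of \<open>c\<close> moves \<open>x\<close> out of the second part.\<close>
    moreover have "c (?d (x \<otimes>\<^bsub>S\<^esub> y) \<odot>\<^bsub>M\<^esub> snd p) =
        c (?d x \<odot>\<^bsub>M\<^esub> (y \<odot>\<^bsub>M\<^esub> snd p)) \<oplus>\<^bsub>B\<^esub> x \<odot>\<^bsub>B\<^esub> c (?d y \<odot>\<^bsub>M\<^esub> snd p)"
    proof -
      have "?d (x \<otimes>\<^bsub>S\<^esub> y) \<odot>\<^bsub>M\<^esub> snd p = (?d x \<otimes>\<^bsub>?T\<^esub> y \<oplus>\<^bsub>?T\<^esub> x \<otimes>\<^bsub>?T\<^esub> ?d y) \<odot>\<^bsub>M\<^esub> snd p"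
        using dmult[OF xy] by simp
      also have "\<dots> = ?d x \<odot>\<^bsub>M\<^esub> (y \<odot>\<^bsub>M\<^esub> snd p) \<oplus>\<^bsub>M\<^esub> x \<odot>\<^bsub>M\<^esub> (?d y \<odot>\<^bsub>M\<^esub> snd p)"
        using xy dT p(2)
        by (simp only: M.smult_l_distr M.smult_assoc1 B.R.m_closed)
      finally show ?thesis using cadd csm xy dT p(2) by simp
    qed
    ultimately show ?case
      using xy p dT cB by (simp add: B.smult_r_distr B.M.a_ac)
  next
    case (6 p)
    then have p: "fst p \<in> carrier B" "snd p \<in> carrier M" by auto
    have "\<one>\<^bsub>S\<^esub> \<odot>\<^bsub>B\<^esub> fst p = fst p" "\<one>\<^bsub>S\<^esub> \<odot>\<^bsub>M\<^esub> snd p = snd p" "\<zero>\<^bsub>S\<^esub> \<odot>\<^bsub>M\<^esub> snd p = \<zero>\<^bsub>M\<^esub>"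
      using B.smult_one[OF p(1)] M.smult_one[OF p(2)] M.smult_l_null[OF p(2)] by simp_all
    then show ?case using p by (simp add: d1 c0)
  qed
  have snd: "snd \<in> linear_maps ?T ?E M" by (auto simp: linear_maps_def)
  have surj: "snd ` carrier ?E = carrier M"
    by (force intro!: image_eqI[of _ snd "(\<zero>\<^bsub>B\<^esub>, _)"])
  \<comment> \<open>The identity of \<open>M\<close> lifts along \<open>snd\<close>. A lift sends
    \<open>m\<close> to a pair \<open>(w m, m)\<close>, and its linearity for the twisted action is
    the required rule for \<open>w\<close>.\<close>
  have "lifts_against ?T M ?E M"
    by (rule projective_module_lifts[OF proj E M.left_module_axioms])
  moreover have "id \<in> linear_maps ?T M M" by (simp add: linear_maps_def)
  ultimately have "\<exists>k\<in>linear_maps ?T M ?E. \<forall>m\<in>carrier M. snd (k m) = id m"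
    using snd surj unfolding lifts_against_def by blast
  then obtain k where k: "k \<in> linear_maps ?T M ?E"
    and sk: "\<And>m. m \<in> carrier M \<Longrightarrow> snd (k m) = m"
    by auto
  show ?thesis
  proof (rule that[of "fst \<circ> k"])
    show "fst \<circ> k \<in> additive_maps M B"
      using k by (force simp: linear_maps_def hom_def)
    show "(fst \<circ> k) (x \<odot>\<^bsub>M\<^esub> m) = x \<odot>\<^bsub>B\<^esub> (fst \<circ> k) m \<oplus>\<^bsub>B\<^esub> c (?d x \<odot>\<^bsub>M\<^esub> m)"
      if "x \<in> homog_span H" "m \<in> carrier M" for x m
      using k that sk by (simp add: linear_maps_def)
  qed
qed

section \<open>Translating additive maps by a degree\<close>

text \<open>
  If \<open>1 = \<Sum>\<^sub>j u\<^sub>j v\<^sub>j\<close> with \<open>u\<^sub>j \<in> A \<tau>\<close> and \<open>v\<^sub>j \<in> A \<tau>\<inverse>\<close>, then \<open>F m = \<Sum>\<^sub>j u\<^sub>j f (v\<^sub>j m)\<close>.  To avoid choosing such a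
  decomposition, \<open>1\<close> is replaced by any element of \<open>A \<tau> A \<tau>\<inverse>\<close> and the claim is proved by induction
  over the additive subgroup generated by the products.
\<close>

lemma translate_exists:
  assumes K: "subgroup K \<Gamma>" and M: "left_module (graded_subring S A K) M"
    and N: "left_module (graded_subring S A K) N"
    and \<tau>: "\<tau> \<in> K" and f: "f \<in> additive_maps M N"
    and lin: "\<And>x m. \<lbrakk>x \<in> A \<one>\<^bsub>\<Gamma>\<^esub>; m \<in> carrier M\<rbrakk> \<Longrightarrow> f (x \<odot>\<^bsub>M\<^esub> m) = x \<odot>\<^bsub>N\<^esub> f m"
  obtains F where "F \<in> additive_maps M N"
    and "\<And>x m. \<lbrakk>x \<in> A \<tau>; m \<in> carrier M\<rbrakk> \<Longrightarrow> F (x \<odot>\<^bsub>M\<^esub> m) = x \<odot>\<^bsub>N\<^esub> f m"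
proof -
  interpret K: subgroup K \<Gamma> by fact
  interpret M: left_module "graded_subring S A K" M by fact
  interpret N: left_module "graded_subring S A K" N by fact
  note comp = homog_span_component[OF K.subset]
  have fN: "f m \<in> carrier N" if "m \<in> carrier M" for m using f that by (auto simp: hom_def)
  have fadd: "f (m \<oplus>\<^bsub>M\<^esub> m') = f m \<oplus>\<^bsub>N\<^esub> f m'" if "m \<in> carrier M" "m' \<in> carrier M" for m m'
    using f that by (auto simp: hom_def)
  have \<tau>G: "\<tau> \<in> carrier \<Gamma>" "inv\<^bsub>\<Gamma>\<^esub> \<tau> \<in> carrier \<Gamma>" using \<tau> by auto
  have \<tau>i: "inv\<^bsub>\<Gamma>\<^esub> \<tau> \<in> K" using \<tau> by simp
  \<comment> \<open>The claim is the case \<open>z = \<one>\<close>. Membership of \<open>z\<close>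
    in R(K) is carried along so that the module laws apply to sums.\<close>
  define P where "P z \<longleftrightarrow> z \<in> homog_span K \<and> (\<exists>F\<in>additive_maps M N. \<forall>x\<in>A \<tau>. \<forall>m\<in>carrier M.
    F (x \<odot>\<^bsub>M\<^esub> m) = (z \<otimes>\<^bsub>S\<^esub> x) \<odot>\<^bsub>N\<^esub> f m)" for z
  have "\<one>\<^bsub>S\<^esub> \<in> A (\<tau> \<otimes>\<^bsub>\<Gamma>\<^esub> inv\<^bsub>\<Gamma>\<^esub> \<tau>)" using one_component \<tau>G by simp
  with \<tau>G have "P \<one>\<^bsub>S\<^esub>"
  proof (induction rule: component_product_induct)
    case (mult a b)
    have ab: "a \<in> homog_span K" "b \<in> homog_span K" using comp \<tau> \<tau>i mult by blast+
    have "(\<lambda>m. a \<odot>\<^bsub>N\<^esub> f (b \<odot>\<^bsub>M\<^esub> m)) \<in> additive_maps M N"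
      using ab fN fadd by (auto simp: hom_def M.smult_r_distr N.smult_r_distr)
    moreover have "a \<odot>\<^bsub>N\<^esub> f (b \<odot>\<^bsub>M\<^esub> (x \<odot>\<^bsub>M\<^esub> m)) = ((a \<otimes>\<^bsub>S\<^esub> b) \<otimes>\<^bsub>S\<^esub> x) \<odot>\<^bsub>N\<^esub> f m"
      if x: "x \<in> A \<tau>" and m: "m \<in> carrier M" for x m
    proof -
      have xT: "x \<in> homog_span K" using comp \<tau> x by blast
      \<comment> \<open>The degree is that of \<open>inv \<tau> \<otimes> \<tau>\<close>, the one in
        which \<open>f\<close> is assumed linear.\<close>
      have bx: "b \<otimes>\<^bsub>S\<^esub> x \<in> A \<one>\<^bsub>\<Gamma>\<^esub>" using component_times[OF \<tau>G(2,1) mult(2) x] \<tau>G by simp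
      have bxT: "b \<otimes>\<^bsub>S\<^esub> x \<in> homog_span K" using comp[OF K.one_closed bx] .
      have "b \<odot>\<^bsub>M\<^esub> (x \<odot>\<^bsub>M\<^esub> m) = (b \<otimes>\<^bsub>S\<^esub> x) \<odot>\<^bsub>M\<^esub> m" using M.smult_assoc1[OF ab(2) xT m] by simp
      then have "a \<odot>\<^bsub>N\<^esub> f (b \<odot>\<^bsub>M\<^esub> (x \<odot>\<^bsub>M\<^esub> m)) = a \<odot>\<^bsub>N\<^esub> ((b \<otimes>\<^bsub>S\<^esub> x) \<odot>\<^bsub>N\<^esub> f m)"
        using lin[OF bx m] by simp
      also have "\<dots> = (a \<otimes>\<^bsub>S\<^esub> (b \<otimes>\<^bsub>S\<^esub> x)) \<odot>\<^bsub>N\<^esub> f m"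
        using N.smult_assoc1[OF ab(1) bxT fN[OF m]] by simp
      also have "a \<otimes>\<^bsub>S\<^esub> (b \<otimes>\<^bsub>S\<^esub> x) = (a \<otimes>\<^bsub>S\<^esub> b) \<otimes>\<^bsub>S\<^esub> x"
        using M.R.m_assoc[OF ab xT] by simp
      finally show ?thesis .
    qed
    ultimately show ?case unfolding P_def using M.R.m_closed[OF ab]
      by (intro conjI bexI[of _ "\<lambda>m. a \<odot>\<^bsub>N\<^esub> f (b \<odot>\<^bsub>M\<^esub> m)"]) auto
  next
    case (add y z)
    then obtain F G where yz: "y \<in> homog_span K" "z \<in> homog_span K"
      and F: "F \<in> additive_maps M N" "\<And>x m. \<lbrakk>x \<in> A \<tau>; m \<in> carrier M\<rbrakk> \<Longrightarrow>
        F (x \<odot>\<^bsub>M\<^esub> m) = (y \<otimes>\<^bsub>S\<^esub> x) \<odot>\<^bsub>N\<^esub> f m"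
      and G: "G \<in> additive_maps M N" "\<And>x m. \<lbrakk>x \<in> A \<tau>; m \<in> carrier M\<rbrakk> \<Longrightarrow>
        G (x \<odot>\<^bsub>M\<^esub> m) = (z \<otimes>\<^bsub>S\<^esub> x) \<odot>\<^bsub>N\<^esub> f m"
      unfolding P_def by blast
    have "(\<lambda>m. F m \<oplus>\<^bsub>N\<^esub> G m) \<in> additive_maps M N"
      using F(1) G(1) by (auto simp: hom_def Pi_def N.M.a_ac)
    moreover have "F (x \<odot>\<^bsub>M\<^esub> m) \<oplus>\<^bsub>N\<^esub> G (x \<odot>\<^bsub>M\<^esub> m) = ((y \<oplus>\<^bsub>S\<^esub> z) \<otimes>\<^bsub>S\<^esub> x) \<odot>\<^bsub>N\<^esub> f m"
      if x: "x \<in> A \<tau>" and m: "m \<in> carrier M" for x m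
    proof -
      have xT: "x \<in> homog_span K" using comp \<tau> x by blast
      have "(y \<oplus>\<^bsub>S\<^esub> z) \<otimes>\<^bsub>S\<^esub> x = y \<otimes>\<^bsub>S\<^esub> x \<oplus>\<^bsub>S\<^esub> z \<otimes>\<^bsub>S\<^esub> x"
        using M.R.l_distr[OF yz xT] by simp
      then show ?thesis
        using N.smult_l_distr[of "y \<otimes>\<^bsub>S\<^esub> x" "z \<otimes>\<^bsub>S\<^esub> x" "f m"] M.R.m_closed yz xT fN m F(2) G(2) x by simp
    qed
    moreover have "y \<oplus>\<^bsub>S\<^esub> z \<in> homog_span K" using M.R.a_closed[OF yz] by simp
    ultimately show ?case unfolding P_def
      by (intro conjI bexI[of _ "\<lambda>m. F m \<oplus>\<^bsub>N\<^esub> G m"]) auto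
  qed
  then obtain F where F: "F \<in> additive_maps M N"
    "\<And>x m. \<lbrakk>x \<in> A \<tau>; m \<in> carrier M\<rbrakk> \<Longrightarrow> F (x \<odot>\<^bsub>M\<^esub> m) = (\<one>\<^bsub>S\<^esub> \<otimes>\<^bsub>S\<^esub> x) \<odot>\<^bsub>N\<^esub> f m"
    unfolding P_def by blast
  then show ?thesis using that[OF F(1)] component_closed[OF \<tau>G(1)] by simp
qed

text \<open>The unit is a sum of products from \<open>A \<tau>\<close> and
  \<open>A (inv \<tau>)\<close>, so \<open>A \<tau>\<close> times \<open>M\<close> generates
  \<open>M\<close> additively. Identities between additive maps can thus be checked on elements
  \<open>x \<odot> m\<close> with \<open>x\<close> in \<open>A \<tau>\<close>.\<close>

lemma translate_unique:
  assumes K: "subgroup K \<Gamma>" and M: "left_module (graded_subring S A K) M"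
    and \<tau>: "\<tau> \<in> K" and F: "F \<in> additive_maps M N" and G: "G \<in> additive_maps M N"
    and eq: "\<And>x m. \<lbrakk>x \<in> A \<tau>; m \<in> carrier M\<rbrakk> \<Longrightarrow> F (x \<odot>\<^bsub>M\<^esub> m) = G (x \<odot>\<^bsub>M\<^esub> m)"
    and m: "m \<in> carrier M"
  shows "F m = G m"
proof -
  interpret K: subgroup K \<Gamma> by fact
  interpret M: left_module "graded_subring S A K" M by fact
  note comp = homog_span_component[OF K.subset]
  have \<tau>G: "\<tau> \<in> carrier \<Gamma>" "inv\<^bsub>\<Gamma>\<^esub> \<tau> \<in> carrier \<Gamma>" using \<tau> by auto
  have \<tau>i: "inv\<^bsub>\<Gamma>\<^esub> \<tau> \<in> K" using \<tau> by simp
  have "\<one>\<^bsub>S\<^esub> \<in> A (\<tau> \<otimes>\<^bsub>\<Gamma>\<^esub> inv\<^bsub>\<Gamma>\<^esub> \<tau>)" using one_component \<tau>G by simp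
  with \<tau>G have "\<one>\<^bsub>S\<^esub> \<in> homog_span K \<and> F (\<one>\<^bsub>S\<^esub> \<odot>\<^bsub>M\<^esub> m) = G (\<one>\<^bsub>S\<^esub> \<odot>\<^bsub>M\<^esub> m)"
  proof (induction rule: component_product_induct)
    case (mult a b)
    have ab: "a \<in> homog_span K" "b \<in> homog_span K" using comp \<tau> \<tau>i mult by blast+
    have "(a \<otimes>\<^bsub>S\<^esub> b) \<odot>\<^bsub>M\<^esub> m = a \<odot>\<^bsub>M\<^esub> (b \<odot>\<^bsub>M\<^esub> m)" using M.smult_assoc1[OF ab m] by simp
    then show ?case using eq[OF mult(1)] ab m M.R.m_closed[OF ab] by simp
  next
    case (add y z)
    then have "(y \<oplus>\<^bsub>S\<^esub> z) \<odot>\<^bsub>M\<^esub> m = y \<odot>\<^bsub>M\<^esub> m \<oplus>\<^bsub>M\<^esub> z \<odot>\<^bsub>M\<^esub> m" "y \<oplus>\<^bsub>S\<^esub> z \<in> homog_span K"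
      using M.smult_l_distr[of y z m] M.R.a_closed[of y z] m by simp_all
    then show ?case using add F G m by (simp add: hom_def)
  qed
  then show ?thesis using M.smult_one[OF m] by simp
qed

text \<open>Moving \<open>y\<close> of degree \<gamma> past \<open>A \<tau>\<close> turns its degree
  into the conjugate \<open>inv \<tau> \<otimes> \<gamma> \<otimes> \<tau>\<close>, so linearity of
  \<open>f\<close> there becomes linearity of its translate \<open>F\<close> at \<gamma>.\<close>

lemma translate_linear:
  assumes K: "subgroup K \<Gamma>" and M: "left_module (graded_subring S A K) M"
    and N: "left_module (graded_subring S A K) N"
    and \<tau>: "\<tau> \<in> K" and \<gamma>: "\<gamma> \<in> K"
    and f: "f \<in> additive_maps M N" and F: "F \<in> additive_maps M N"
    and trans: "\<And>x m. \<lbrakk>x \<in> A \<tau>; m \<in> carrier M\<rbrakk> \<Longrightarrow> F (x \<odot>\<^bsub>M\<^esub> m) = x \<odot>\<^bsub>N\<^esub> f m"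
    and lin: "\<And>x m. \<lbrakk>x \<in> A (inv\<^bsub>\<Gamma>\<^esub> \<tau> \<otimes>\<^bsub>\<Gamma>\<^esub> \<gamma> \<otimes>\<^bsub>\<Gamma>\<^esub> \<tau>); m \<in> carrier M\<rbrakk> \<Longrightarrow>
      f (x \<odot>\<^bsub>M\<^esub> m) = x \<odot>\<^bsub>N\<^esub> f m"
    and y: "y \<in> A \<gamma>" and m: "m \<in> carrier M"
  shows "F (y \<odot>\<^bsub>M\<^esub> m) = y \<odot>\<^bsub>N\<^esub> F m"
proof -
  interpret K: subgroup K \<Gamma> by fact
  interpret M: left_module "graded_subring S A K" M by fact
  interpret N: left_module "graded_subring S A K" N by fact
  note comp = homog_span_component[OF K.subset]
  let ?\<sigma> = "inv\<^bsub>\<Gamma>\<^esub> \<tau> \<otimes>\<^bsub>\<Gamma>\<^esub> \<gamma> \<otimes>\<^bsub>\<Gamma>\<^esub> \<tau>"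
  have G: "\<tau> \<in> carrier \<Gamma>" "\<gamma> \<in> carrier \<Gamma>" "?\<sigma> \<in> carrier \<Gamma>" using \<tau> \<gamma> by auto
  have \<sigma>: "?\<sigma> \<in> K" using \<tau> \<gamma> by simp
  have fN: "f m \<in> carrier N" if "m \<in> carrier M" for m using f that by (auto simp: hom_def)
  have yT: "y \<in> homog_span K" using comp[OF \<gamma> y] .
  have conj: "\<tau> \<otimes>\<^bsub>\<Gamma>\<^esub> ?\<sigma> = \<gamma> \<otimes>\<^bsub>\<Gamma>\<^esub> \<tau>"
    using G(1,2) by (simp add: \<Gamma>.m_assoc[symmetric])
  \<comment> \<open>For \<open>z = a \<otimes> b\<close> the factor \<open>a\<close> is handled by
    the translation rule and \<open>b\<close> by the linearity of \<open>f\<close>.\<close>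
  have key: "F (z \<odot>\<^bsub>M\<^esub> m) = z \<odot>\<^bsub>N\<^esub> f m" if z: "z \<in> A (\<tau> \<otimes>\<^bsub>\<Gamma>\<^esub> ?\<sigma>)" and m: "m \<in> carrier M" for z m
  proof -
    have "z \<in> homog_span K \<and> F (z \<odot>\<^bsub>M\<^esub> m) = z \<odot>\<^bsub>N\<^esub> f m"
      using G(1,3) z
    proof (induction rule: component_product_induct)
      case (mult a b)
      have ab: "a \<in> homog_span K" "b \<in> homog_span K" using comp \<tau> \<sigma> mult by blast+
      have "(a \<otimes>\<^bsub>S\<^esub> b) \<odot>\<^bsub>M\<^esub> m = a \<odot>\<^bsub>M\<^esub> (b \<odot>\<^bsub>M\<^esub> m)" using M.smult_assoc1[OF ab m] by simp
      moreover have "(a \<otimes>\<^bsub>S\<^esub> b) \<odot>\<^bsub>N\<^esub> f m = a \<odot>\<^bsub>N\<^esub> (b \<odot>\<^bsub>N\<^esub> f m)"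
        using N.smult_assoc1[OF ab fN[OF m]] by simp
      ultimately show ?case
        using trans[OF mult(1)] lin[OF mult(2) m] ab m M.R.m_closed[OF ab] by simp
    next
      case (add u v)
      then have "(u \<oplus>\<^bsub>S\<^esub> v) \<odot>\<^bsub>M\<^esub> m = u \<odot>\<^bsub>M\<^esub> m \<oplus>\<^bsub>M\<^esub> v \<odot>\<^bsub>M\<^esub> m" "u \<oplus>\<^bsub>S\<^esub> v \<in> homog_span K"
        "(u \<oplus>\<^bsub>S\<^esub> v) \<odot>\<^bsub>N\<^esub> f m = u \<odot>\<^bsub>N\<^esub> f m \<oplus>\<^bsub>N\<^esub> v \<odot>\<^bsub>N\<^esub> f m"
        using M.smult_l_distr[of u v m] M.R.a_closed[of u v] m N.smult_l_distr[of u v "f m"] fN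
        by simp_all
      then show ?case using add F m by (simp add: hom_def)
    qed
    then show ?thesis ..
  qed
  show ?thesis
  proof (rule translate_unique[OF K M \<tau> _ _ _ m])
    show "(\<lambda>m. F (y \<odot>\<^bsub>M\<^esub> m)) \<in> additive_maps M N" "(\<lambda>m. y \<odot>\<^bsub>N\<^esub> F m) \<in> additive_maps M N"
      using F yT by (auto simp: hom_def Pi_def M.smult_r_distr N.smult_r_distr)
    fix x m assume x: "x \<in> A \<tau>" and m: "m \<in> carrier M"
    have xT: "x \<in> homog_span K" using comp[OF \<tau> x] .
    have yx: "y \<otimes>\<^bsub>S\<^esub> x \<in> A (\<tau> \<otimes>\<^bsub>\<Gamma>\<^esub> ?\<sigma>)"
      unfolding conj by (rule component_times[OF G(2,1) y x])
    have "F (y \<odot>\<^bsub>M\<^esub> (x \<odot>\<^bsub>M\<^esub> m)) = F ((y \<otimes>\<^bsub>S\<^esub> x) \<odot>\<^bsub>M\<^esub> m)"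
      using M.smult_assoc1[OF yT xT m] by simp
    also have "\<dots> = (y \<otimes>\<^bsub>S\<^esub> x) \<odot>\<^bsub>N\<^esub> f m" by (rule key[OF yx m])
    also have "\<dots> = y \<odot>\<^bsub>N\<^esub> F (x \<odot>\<^bsub>M\<^esub> m)"
      using N.smult_assoc1[OF yT xT fN[OF m]] trans[OF x m] by simp
    finally show "F (y \<odot>\<^bsub>M\<^esub> (x \<odot>\<^bsub>M\<^esub> m)) = y \<odot>\<^bsub>N\<^esub> F (x \<odot>\<^bsub>M\<^esub> m)" .
  qed
qed

section \<open>Spreading linearity from some degrees to others\<close>

text \<open>Sums of products from \<open>A \<gamma>\<close> and \<open>A \<tau>\<close> fill the
  component of the product degree, and linearity passes to products and sums of scalars.\<close>

lemma linear_at_mult: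
  assumes K: "subgroup K \<Gamma>" and M: "left_module (graded_subring S A K) M"
    and N: "left_module (graded_subring S A K) N"
    and f: "f \<in> additive_maps M N" and \<gamma>: "\<gamma> \<in> K" and \<tau>: "\<tau> \<in> K"
    and lin: "\<And>x m. \<lbrakk>x \<in> A \<gamma> \<union> A \<tau>; m \<in> carrier M\<rbrakk> \<Longrightarrow> f (x \<odot>\<^bsub>M\<^esub> m) = x \<odot>\<^bsub>N\<^esub> f m"
    and x: "x \<in> A (\<gamma> \<otimes>\<^bsub>\<Gamma>\<^esub> \<tau>)" and m: "m \<in> carrier M"
  shows "f (x \<odot>\<^bsub>M\<^esub> m) = x \<odot>\<^bsub>N\<^esub> f m"
proof -
  interpret K: subgroup K \<Gamma> by fact
  interpret M: left_module "graded_subring S A K" M by fact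
  interpret N: left_module "graded_subring S A K" N by fact
  note comp = homog_span_component[OF K.subset]
  have fN: "f m \<in> carrier N" if "m \<in> carrier M" for m using f that by (auto simp: hom_def)
  have G: "\<gamma> \<in> carrier \<Gamma>" "\<tau> \<in> carrier \<Gamma>" using \<gamma> \<tau> by auto
  have "x \<in> homog_span K \<and> f (x \<odot>\<^bsub>M\<^esub> m) = x \<odot>\<^bsub>N\<^esub> f m"
    using G x
  proof (induction rule: component_product_induct)
    case (mult a b)
    have ab: "a \<in> homog_span K" "b \<in> homog_span K" using comp \<gamma> \<tau> mult by blast+
    have "(a \<otimes>\<^bsub>S\<^esub> b) \<odot>\<^bsub>M\<^esub> m = a \<odot>\<^bsub>M\<^esub> (b \<odot>\<^bsub>M\<^esub> m)" using M.smult_assoc1[OF ab m] by simp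
    moreover have "(a \<otimes>\<^bsub>S\<^esub> b) \<odot>\<^bsub>N\<^esub> f m = a \<odot>\<^bsub>N\<^esub> (b \<odot>\<^bsub>N\<^esub> f m)"
      using N.smult_assoc1[OF ab fN[OF m]] by simp
    ultimately show ?case
      using lin mult ab m M.R.m_closed[OF ab] by simp
  next
    case (add u v)
    then have "(u \<oplus>\<^bsub>S\<^esub> v) \<odot>\<^bsub>M\<^esub> m = u \<odot>\<^bsub>M\<^esub> m \<oplus>\<^bsub>M\<^esub> v \<odot>\<^bsub>M\<^esub> m" "u \<oplus>\<^bsub>S\<^esub> v \<in> homog_span K"
      "(u \<oplus>\<^bsub>S\<^esub> v) \<odot>\<^bsub>N\<^esub> f m = u \<odot>\<^bsub>N\<^esub> f m \<oplus>\<^bsub>N\<^esub> v \<odot>\<^bsub>N\<^esub> f m"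
      using M.smult_l_distr[of u v m] M.R.a_closed[of u v] m N.smult_l_distr[of u v "f m"] fN
      by simp_all
    then show ?case using add f m by (simp add: hom_def)
  qed
  then show ?thesis ..
qed

text \<open>Evaluated at \<open>x \<odot> m\<close> with \<open>x\<close> in
  \<open>A \<gamma>\<close>, both sides become \<open>(y \<otimes> x) \<odot> f m\<close>, as
  \<open>y \<otimes> x\<close> has degree \<one>; such elements suffice by
  \<open>translate_unique\<close>.\<close>

lemma linear_at_inv:
  assumes K: "subgroup K \<Gamma>" and M: "left_module (graded_subring S A K) M"
    and N: "left_module (graded_subring S A K) N"
    and f: "f \<in> additive_maps M N" and \<gamma>: "\<gamma> \<in> K"
    and lin: "\<And>x m. \<lbrakk>x \<in> A \<one>\<^bsub>\<Gamma>\<^esub> \<union> A \<gamma>; m \<in> carrier M\<rbrakk> \<Longrightarrow> f (x \<odot>\<^bsub>M\<^esub> m) = x \<odot>\<^bsub>N\<^esub> f m"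
    and y: "y \<in> A (inv\<^bsub>\<Gamma>\<^esub> \<gamma>)" and m: "m \<in> carrier M"
  shows "f (y \<odot>\<^bsub>M\<^esub> m) = y \<odot>\<^bsub>N\<^esub> f m"
proof -
  interpret K: subgroup K \<Gamma> by fact
  interpret M: left_module "graded_subring S A K" M by fact
  interpret N: left_module "graded_subring S A K" N by fact
  note comp = homog_span_component[OF K.subset]
  have fN: "f m \<in> carrier N" if "m \<in> carrier M" for m using f that by (auto simp: hom_def)
  have yT: "y \<in> homog_span K" using comp[OF K.m_inv_closed[OF \<gamma>] y] .
  show ?thesis
  proof (rule translate_unique[OF K M \<gamma> _ _ _ m])
    show "(\<lambda>m. f (y \<odot>\<^bsub>M\<^esub> m)) \<in> additive_maps M N" "(\<lambda>m. y \<odot>\<^bsub>N\<^esub> f m) \<in> additive_maps M N"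
      using f yT by (auto simp: hom_def Pi_def M.smult_r_distr N.smult_r_distr)
    fix x m assume x: "x \<in> A \<gamma>" and m: "m \<in> carrier M"
    have xT: "x \<in> homog_span K" using comp[OF \<gamma> x] .
    have yx: "y \<otimes>\<^bsub>S\<^esub> x \<in> A \<one>\<^bsub>\<Gamma>\<^esub>"
      using component_times[of "inv\<^bsub>\<Gamma>\<^esub> \<gamma>" \<gamma> y x] \<gamma> y x by simp
    have "f (y \<odot>\<^bsub>M\<^esub> (x \<odot>\<^bsub>M\<^esub> m)) = f ((y \<otimes>\<^bsub>S\<^esub> x) \<odot>\<^bsub>M\<^esub> m)"
      using M.smult_assoc1[OF yT xT m] by simp
    also have "\<dots> = (y \<otimes>\<^bsub>S\<^esub> x) \<odot>\<^bsub>N\<^esub> f m" using lin yx m by blast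
    also have "\<dots> = y \<odot>\<^bsub>N\<^esub> f (x \<odot>\<^bsub>M\<^esub> m)"
      using N.smult_assoc1[OF yT xT fN[OF m]] lin x m by simp
    finally show "f (y \<odot>\<^bsub>M\<^esub> (x \<odot>\<^bsub>M\<^esub> m)) = y \<odot>\<^bsub>N\<^esub> f (x \<odot>\<^bsub>M\<^esub> m)" .
  qed
qed

lemma linear_mapsI:
  assumes K: "subgroup K \<Gamma>" and M: "left_module (graded_subring S A K) M"
    and N: "left_module (graded_subring S A K) N"
    and f: "f \<in> additive_maps M N"
    and lin: "\<And>\<gamma> x m. \<lbrakk>\<gamma> \<in> K; x \<in> A \<gamma>; m \<in> carrier M\<rbrakk> \<Longrightarrow> f (x \<odot>\<^bsub>M\<^esub> m) = x \<odot>\<^bsub>N\<^esub> f m"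
  shows "f \<in> linear_maps (graded_subring S A K) M N"
proof -
  interpret K: subgroup K \<Gamma> by fact
  interpret M: left_module "graded_subring S A K" M by fact
  interpret N: left_module "graded_subring S A K" N by fact
  have fN: "f m \<in> carrier N" if "m \<in> carrier M" for m using f that by (auto simp: hom_def)
  have "f (x \<odot>\<^bsub>M\<^esub> m) = x \<odot>\<^bsub>N\<^esub> f m" if x: "x \<in> homog_span K" and m: "m \<in> carrier M" for x m
    using K.subset x
  proof (induction rule: homog_span_induct)
    case zero
    have "f \<zero>\<^bsub>M\<^esub> \<oplus>\<^bsub>N\<^esub> f \<zero>\<^bsub>M\<^esub> = f \<zero>\<^bsub>M\<^esub>"
      using hom_mult[OF f, of "\<zero>\<^bsub>M\<^esub>" "\<zero>\<^bsub>M\<^esub>"] by simp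
    then have "f \<zero>\<^bsub>M\<^esub> = \<zero>\<^bsub>N\<^esub>" using fN[OF M.M.zero_closed] by simp
    then show ?case using M.smult_l_null[OF m] N.smult_l_null[OF fN[OF m]] by simp
  next
    case (component \<gamma> x)
    then show ?case using lin m by blast
  next
    case (add u v)
    then have "(u \<oplus>\<^bsub>S\<^esub> v) \<odot>\<^bsub>M\<^esub> m = u \<odot>\<^bsub>M\<^esub> m \<oplus>\<^bsub>M\<^esub> v \<odot>\<^bsub>M\<^esub> m"
      "(u \<oplus>\<^bsub>S\<^esub> v) \<odot>\<^bsub>N\<^esub> f m = u \<odot>\<^bsub>N\<^esub> f m \<oplus>\<^bsub>N\<^esub> v \<odot>\<^bsub>N\<^esub> f m"
      using M.smult_l_distr[of u v m] m N.smult_l_distr[of u v "f m"] fN by simp_all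
    then show ?case using add f m by (simp add: hom_def)
  qed
  then show ?thesis using f by (auto simp: linear_maps_def hom_def)
qed

lemma left_module_subgroup:
  assumes "subgroup H \<Gamma>" "subgroup K \<Gamma>" "H \<subseteq> K" "left_module (graded_subring S A K) M"
  shows "left_module (graded_subring S A H) M"
  using left_module_restrict[where R = S and C = "homog_span K" and D = "homog_span H"] assms graded_subring_ring[OF assms(1)]
    homog_span_mono[OF assms(3) subgroup.subset[OF assms(2)]]
  by (simp add: graded_subring_def)

section \<open>Ascent of projectivity along one cyclic step\<close>

text \<open>The action \<sigma> is not a constant here: \<open>s1\<close> stands for \<sigma>
  applied to \<open>s\<close>, \<open>W i\<close> for its i-th iterate on \<open>w\<close>, and
  \<open>F j\<close> for the sum of the first \<open>j\<close> iterates. Each translate is pinned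
  down by its values on products with elements of degree \<open>t\<close> or
  \<open>t [^] i\<close>.\<close>

lemma lifts_against_cyclic_extension:
  fixes \<psi> :: "'g \<Rightarrow> int" and n :: nat
  assumes K: "subgroup K \<Gamma>" and H: "subgroup H \<Gamma>" and n: "0 < n"
    and \<psi>: "\<And>\<gamma> \<tau>. \<lbrakk>\<gamma> \<in> K; \<tau> \<in> K\<rbrakk> \<Longrightarrow> \<psi> (\<gamma> \<otimes>\<^bsub>\<Gamma>\<^esub> \<tau>) = \<psi> \<gamma> + \<psi> \<tau>"
    and t: "t \<in> K" "\<psi> t = 1" and HK: "H = {\<gamma> \<in> K. int n dvd \<psi> \<gamma>}"
    and M: "left_module (graded_subring S A K) M"
    and proj: "projective_module (graded_subring S A H) M"
    and P: "left_module (graded_subring S A K) P"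
    and Q: "left_module (graded_subring S A K) Q"
  shows "lifts_against (graded_subring S A K) M P Q"
  unfolding lifts_against_def
proof (intro ballI impI)
  fix g h
  assume g: "g \<in> linear_maps (graded_subring S A K) P Q" and surj: "g ` carrier P = carrier Q"
    and h: "h \<in> linear_maps (graded_subring S A K) M Q"
  interpret K: subgroup K \<Gamma> by fact
  interpret M: left_module "graded_subring S A K" M by fact
  interpret P: left_module "graded_subring S A K" P by fact
  interpret Q: left_module "graded_subring S A K" Q by fact
  have sub: "H \<subseteq> K" using HK by auto
  note comp = homog_span_component[OF K.subset]
  have mono: "homog_span H \<subseteq> homog_span K" by (rule homog_span_mono[OF sub K.subset])
  note restrict = left_module_subgroup[OF H K sub]

  have \<psi>1: "\<psi> \<one>\<^bsub>\<Gamma>\<^esub> = 0" using \<psi>[of "\<one>\<^bsub>\<Gamma>\<^esub>" "\<one>\<^bsub>\<Gamma>\<^esub>"] by simp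
  have \<psi>inv: "\<psi> (inv\<^bsub>\<Gamma>\<^esub> \<gamma>) = - \<psi> \<gamma>" if "\<gamma> \<in> K" for \<gamma>
    using \<psi>[of "inv\<^bsub>\<Gamma>\<^esub> \<gamma>" \<gamma>] that \<psi>1 by simp
  \<comment> \<open>The integers are commutative, so \<open>H\<close> and ker \<psi> are stable
    under conjugation, and translates keep linearity in these degrees.\<close>
  have \<psi>conj: "\<psi> (inv\<^bsub>\<Gamma>\<^esub> \<tau> \<otimes>\<^bsub>\<Gamma>\<^esub> \<gamma> \<otimes>\<^bsub>\<Gamma>\<^esub> \<tau>) = \<psi> \<gamma>" if "\<tau> \<in> K" "\<gamma> \<in> K" for \<tau> \<gamma>
    using \<psi> \<psi>inv that by simp
  have tpow: "t [^]\<^bsub>\<Gamma>\<^esub> i \<in> K" for i :: nat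
    using t(1) by (induction i) auto
  have \<psi>pow: "\<psi> (t [^]\<^bsub>\<Gamma>\<^esub> i) = int i" for i :: nat
    using t tpow by (induction i) (auto simp: \<psi>1 \<psi>)

  have gP: "g p \<in> carrier Q" if "p \<in> carrier P" for p using g that by (auto simp: linear_maps_def)
  have gadd: "g (p \<oplus>\<^bsub>P\<^esub> q) = g p \<oplus>\<^bsub>Q\<^esub> g q" if "p \<in> carrier P" "q \<in> carrier P" for p q
    using g that by (auto simp: linear_maps_def)
  have gsm: "g (x \<odot>\<^bsub>P\<^esub> p) = x \<odot>\<^bsub>Q\<^esub> g p" if "x \<in> homog_span K" "p \<in> carrier P" for x p
    using g that by (auto simp: linear_maps_def)
  have hadd: "h \<in> additive_maps M Q" using h by (auto simp: linear_maps_def hom_def)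
  have hsm: "h (x \<odot>\<^bsub>M\<^esub> m) = x \<odot>\<^bsub>Q\<^esub> h m" if "x \<in> homog_span K" "m \<in> carrier M" for x m
    using h that by (auto simp: linear_maps_def)

  have gH: "g \<in> linear_maps (graded_subring S A H) P Q"
    and hH: "h \<in> linear_maps (graded_subring S A H) M Q"
    using g h mono by (auto simp: linear_maps_def)
  have "lifts_against (graded_subring S A H) M P Q"
    by (rule projective_module_lifts[OF proj restrict[OF P] restrict[OF Q]])
  then obtain s where s: "s \<in> linear_maps (graded_subring S A H) M P"
    and gs: "\<And>m. m \<in> carrier M \<Longrightarrow> g (s m) = h m"
    unfolding lifts_against_def using gH hH surj by blast
  have sadd: "s \<in> additive_maps M P" using s by (auto simp: linear_maps_def hom_def)
  have slin: "s (x \<odot>\<^bsub>M\<^esub> m) = x \<odot>\<^bsub>P\<^esub> s m" if "\<gamma> \<in> H" "x \<in> A \<gamma>" "m \<in> carrier M" for \<gamma> x m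
    using s that homog_span_component[OF subgroup.subset[OF H]] by (auto simp: linear_maps_def)
  have sP: "s m \<in> carrier P" if "m \<in> carrier M" for m using hom_in_carrier[OF sadd] that by simp
  have add_maps: "f (m \<oplus>\<^bsub>M\<^esub> m') = f m \<oplus>\<^bsub>P\<^esub> f m'"
    if "f \<in> additive_maps M P" "m \<in> carrier M" "m' \<in> carrier M" for f m m'
    using hom_mult[OF that(1)] that(2,3) by simp

  obtain s1 where s1: "s1 \<in> additive_maps M P"
    and s1t: "\<And>x m. \<lbrakk>x \<in> A t; m \<in> carrier M\<rbrakk> \<Longrightarrow> s1 (x \<odot>\<^bsub>M\<^esub> m) = x \<odot>\<^bsub>P\<^esub> s m"
    using translate_exists[OF K M P t(1) sadd] slin subgroup.one_closed[OF H] by metis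
  have s1P: "s1 m \<in> carrier P" if "m \<in> carrier M" for m using hom_in_carrier[OF s1] that by simp
  \<comment> \<open>A translate of a lift is a lift: \<open>g \<circ> s1\<close> and
    \<open>h\<close> agree on products with elements of degree \<open>t\<close>. Hence
    \<open>c\<close> below has values in ker \<open>g\<close>.\<close>
  have gs1: "g (s1 m) = h m" if m: "m \<in> carrier M" for m
  proof (rule translate_unique[OF K M t(1) _ hadd _ m])
    show "(\<lambda>m. g (s1 m)) \<in> additive_maps M Q"
      using s1P gP gadd add_maps[OF s1] by (auto simp: hom_def)
    fix x m assume x: "x \<in> A t" and m: "m \<in> carrier M"
    show "g (s1 (x \<odot>\<^bsub>M\<^esub> m)) = h (x \<odot>\<^bsub>M\<^esub> m)"
      using s1t[OF x m] gsm hsm gs[OF m] sP[OF m] comp[OF t(1) x] m by simp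
  qed
  have s1lin: "s1 (x \<odot>\<^bsub>M\<^esub> m) = x \<odot>\<^bsub>P\<^esub> s1 m" if \<gamma>: "\<gamma> \<in> H" "x \<in> A \<gamma>" "m \<in> carrier M" for \<gamma> x m
  proof (rule translate_linear[OF K M P t(1) _ sadd s1 s1t _ \<gamma>(2,3)])
    show "\<gamma> \<in> K" using \<gamma>(1) sub by blast
    then have "inv\<^bsub>\<Gamma>\<^esub> t \<otimes>\<^bsub>\<Gamma>\<^esub> \<gamma> \<otimes>\<^bsub>\<Gamma>\<^esub> t \<in> H" using \<psi>conj[OF t(1)] \<gamma>(1) t(1) by (simp add: HK)
    then show "s (y \<odot>\<^bsub>M\<^esub> m) = y \<odot>\<^bsub>P\<^esub> s m"
      if "y \<in> A (inv\<^bsub>\<Gamma>\<^esub> t \<otimes>\<^bsub>\<Gamma>\<^esub> \<gamma> \<otimes>\<^bsub>\<Gamma>\<^esub> t)" "m \<in> carrier M" for y m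
      using slin that by blast
  qed

  define B where "B = P\<lparr>carrier := {p \<in> carrier P. g p = \<zero>\<^bsub>Q\<^esub>}\<rparr>"
  have B_simps: "carrier B = {p \<in> carrier P. g p = \<zero>\<^bsub>Q\<^esub>}" "p \<oplus>\<^bsub>B\<^esub> q = p \<oplus>\<^bsub>P\<^esub> q" "x \<odot>\<^bsub>B\<^esub> p = x \<odot>\<^bsub>P\<^esub> p"
    for p q x by (simp_all add: B_def)
  have B: "left_module (graded_subring S A K) B"
    unfolding B_def by (rule kernel_left_module[OF P Q g])
  have toP: "f \<in> additive_maps M P" if "f \<in> additive_maps M B" for f
    using that by (auto simp: hom_def B_simps)
  have ker: "f m \<in> carrier P" "g (f m) = \<zero>\<^bsub>Q\<^esub>" if "f \<in> additive_maps M B" "m \<in> carrier M" for f m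
    using that by (auto simp: hom_def B_simps)

  define c where "c m = s1 m \<oplus>\<^bsub>P\<^esub> \<ominus>\<^bsub>P\<^esub> s m" for m
  have c_eq: "c m \<oplus>\<^bsub>P\<^esub> s m = s1 m" if "m \<in> carrier M" for m
    using s1P[OF that] sP[OF that] by (simp add: c_def P.M.a_assoc P.M.l_neg)
  have c: "c \<in> linear_maps (graded_subring S A H) M B"
  proof (rule linear_mapsI[OF H restrict[OF M] restrict[OF B]])
    have "g (c m) = \<zero>\<^bsub>Q\<^esub>" if m: "m \<in> carrier M" for m
    proof -
      have "g (c m) \<oplus>\<^bsub>Q\<^esub> h m = h m"
        using gadd[of "c m" "s m"] c_eq[OF m] gs[OF m] gs1[OF m] s1P[OF m] sP[OF m]
        by (simp add: c_def)
      moreover have "g (c m) \<in> carrier Q" "h m \<in> carrier Q"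
        using gP s1P[OF m] sP[OF m] gs[OF m, symmetric] by (auto simp: c_def)
      ultimately show ?thesis by simp
    qed
    then show "c \<in> additive_maps M B"
      using s1P sP add_maps[OF s1] add_maps[OF sadd]
      by (auto simp: hom_def B_simps c_def P.M.minus_add P.M.a_ac)
    fix \<gamma> x m assume \<gamma>: "\<gamma> \<in> H" "x \<in> A \<gamma>" "m \<in> carrier M"
    have x: "x \<in> homog_span K" using comp[of \<gamma> x] \<gamma> sub by blast
    have "x \<odot>\<^bsub>P\<^esub> (\<ominus>\<^bsub>P\<^esub> s m) = \<ominus>\<^bsub>P\<^esub> (x \<odot>\<^bsub>P\<^esub> s m)"
      using P.smult_r_distr[OF x, of "\<ominus>\<^bsub>P\<^esub> s m" "s m"] sP[OF \<gamma>(3)] x P.smult_r_null[OF x]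
      by (intro P.M.minus_equality[symmetric]) (simp_all add: P.M.l_neg)
    then show "c (x \<odot>\<^bsub>M\<^esub> m) = x \<odot>\<^bsub>B\<^esub> c m"
      using s1lin[OF \<gamma>] slin[OF \<gamma>] s1P sP \<gamma> x by (simp add: c_def B_simps P.smult_r_distr)
  qed

  \<comment> \<open>On \<open>H\<close> the division is exact, so \<kappa> is a homomorphism there;
    it is 0 on ker \<psi> and 1 at \<open>t [^] n\<close>.\<close>
  define \<kappa> where "\<kappa> \<gamma> = \<psi> \<gamma> div int n" for \<gamma>
  have \<kappa>: "\<kappa> (\<gamma> \<otimes>\<^bsub>\<Gamma>\<^esub> \<tau>) = \<kappa> \<gamma> + \<kappa> \<tau>" if "\<gamma> \<in> H" "\<tau> \<in> H" for \<gamma> \<tau>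
    using that \<psi> by (simp add: \<kappa>_def HK div_plus_div_distrib_dvd_left)
  obtain w where w: "w \<in> additive_maps M B"
    and wt: "\<And>x m. \<lbrakk>x \<in> homog_span H; m \<in> carrier M\<rbrakk> \<Longrightarrow>
      w (x \<odot>\<^bsub>M\<^esub> m) = x \<odot>\<^bsub>B\<^esub> w m \<oplus>\<^bsub>B\<^esub> c (degree_derivation \<kappa> x \<odot>\<^bsub>M\<^esub> m)"
    using twisted_splitting[of H B M c \<kappa>, OF H restrict[OF B] proj c \<kappa>] by blast
  have wdeg: "w (x \<odot>\<^bsub>M\<^esub> m) = x \<odot>\<^bsub>P\<^esub> w m \<oplus>\<^bsub>P\<^esub> c (([\<kappa> \<gamma>] \<cdot>\<^bsub>S\<^esub> x) \<odot>\<^bsub>M\<^esub> m)"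
    if "\<gamma> \<in> H" "x \<in> A \<gamma>" "m \<in> carrier M" for \<gamma> x m
  proof -
    have "\<gamma> \<in> carrier \<Gamma>" using that(1) subgroup.subset[OF H] by blast
    then show ?thesis
      using wt[OF homog_span_component[OF subgroup.subset[OF H] that(1,2)] that(3)]
        degree_derivation_component that(2) by (simp add: B_simps)
  qed
  have wP: "w m \<in> carrier P" if "m \<in> carrier M" for m using ker[OF w] that by simp
  have cP: "c m \<in> carrier P" if "m \<in> carrier M" for m using s1P sP that by (simp add: c_def)
  have c0: "c \<zero>\<^bsub>M\<^esub> = \<zero>\<^bsub>P\<^esub>"
  proof -
    interpret MH: left_module "graded_subring S A H" M by (rule restrict[OF M])
    show ?thesis using MH.linear_maps_zero[OF restrict[OF B] c] by (simp add: B_def)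
  qed
  \<comment> \<open>The twist vanishes where \<psi> is 0, so \<open>w\<close> is linear in these
    degrees; in degree \<one> this is what allows translating it.\<close>
  have wlin: "w (x \<odot>\<^bsub>M\<^esub> m) = x \<odot>\<^bsub>B\<^esub> w m"
    if \<gamma>: "\<gamma> \<in> K" "\<psi> \<gamma> = 0" "x \<in> A \<gamma>" "m \<in> carrier M" for \<gamma> x m
  proof -
    have "[\<kappa> \<gamma>] \<cdot>\<^bsub>S\<^esub> x = \<zero>\<^bsub>S\<^esub>" by (simp add: \<kappa>_def \<gamma>(2) add_pow_int_ge)
    moreover have "\<zero>\<^bsub>S\<^esub> \<odot>\<^bsub>M\<^esub> m = \<zero>\<^bsub>M\<^esub>" using M.smult_l_null[OF \<gamma>(4)] by simp
    moreover have "x \<in> homog_span K" using comp \<gamma> by blast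
    ultimately show ?thesis
      using wdeg[of \<gamma> x m] \<gamma> wP[OF \<gamma>(4)] c0 by (simp add: HK B_simps)
  qed

  have "\<exists>F. F \<in> additive_maps M B \<and>
    (\<forall>x\<in>A (t [^]\<^bsub>\<Gamma>\<^esub> i). \<forall>m\<in>carrier M. F (x \<odot>\<^bsub>M\<^esub> m) = x \<odot>\<^bsub>B\<^esub> w m)" for i :: nat
    using translate_exists[OF K M B tpow w] wlin[OF K.one_closed \<psi>1] by metis
  then obtain W where W: "\<And>i::nat. W i \<in> additive_maps M B"
    and Wt: "\<And>i x m. \<lbrakk>x \<in> A (t [^]\<^bsub>\<Gamma>\<^esub> i); m \<in> carrier M\<rbrakk> \<Longrightarrow> W i (x \<odot>\<^bsub>M\<^esub> m) = x \<odot>\<^bsub>B\<^esub> w m"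
    by metis
  have WP: "W i m \<in> carrier P" if "m \<in> carrier M" for i m using ker[OF W] that by simp
  have W0: "W 0 m = w m" if "m \<in> carrier M" for m
    using translate_unique[OF K M K.one_closed W[of 0] w _ that] Wt[of _ 0] wlin[OF K.one_closed \<psi>1]
    by simp
  have Wlin: "W i (x \<odot>\<^bsub>M\<^esub> m) = x \<odot>\<^bsub>P\<^esub> W i m"
    if \<gamma>: "\<gamma> \<in> K" "\<psi> \<gamma> = 0" "x \<in> A \<gamma>" "m \<in> carrier M" for i \<gamma> x m
    using translate_linear[OF K M B tpow \<gamma>(1) w W Wt _ \<gamma>(3,4), of i]
      wlin[of "inv\<^bsub>\<Gamma>\<^esub> (t [^]\<^bsub>\<Gamma>\<^esub> i) \<otimes>\<^bsub>\<Gamma>\<^esub> \<gamma> \<otimes>\<^bsub>\<Gamma>\<^esub> (t [^]\<^bsub>\<Gamma>\<^esub> i)"] \<psi>conj[OF tpow \<gamma>(1)] \<gamma>(1,2) tpow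
    by (simp add: B_simps)
  \<comment> \<open>\<open>W (Suc i)\<close> is the translate of \<open>W i\<close> by
    \<open>t\<close>: at \<open>y \<odot> m\<close> with \<open>y\<close> of degree
    \<open>t [^] i\<close> both sides are \<open>(x \<otimes> y) \<odot> w m\<close>.\<close>
  have Wstep: "x \<odot>\<^bsub>P\<^esub> W i m = W (Suc i) (x \<odot>\<^bsub>M\<^esub> m)"
    if x: "x \<in> A t" and m: "m \<in> carrier M" for i x m
  proof (rule translate_unique[OF K M tpow[of i] _ _ _ m])
    have xT: "x \<in> homog_span K" using comp[OF t(1) x] .
    show "(\<lambda>m. x \<odot>\<^bsub>P\<^esub> W i m) \<in> additive_maps M P" "(\<lambda>m. W (Suc i) (x \<odot>\<^bsub>M\<^esub> m)) \<in> additive_maps M P"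
      using WP xT add_maps[OF toP[OF W]] by (auto simp: hom_def M.smult_r_distr P.smult_r_distr)
    fix y m assume y: "y \<in> A (t [^]\<^bsub>\<Gamma>\<^esub> i)" and m: "m \<in> carrier M"
    have yT: "y \<in> homog_span K" using comp[OF tpow y] .
    have "x \<otimes>\<^bsub>S\<^esub> y \<in> A (t [^]\<^bsub>\<Gamma>\<^esub> Suc i)"
      using component_times[of t "t [^]\<^bsub>\<Gamma>\<^esub> i" x y] x y t(1) by (simp only: \<Gamma>.nat_pow_Suc2 K.mem_carrier \<Gamma>.nat_pow_closed)
    then have "W (Suc i) ((x \<otimes>\<^bsub>S\<^esub> y) \<odot>\<^bsub>M\<^esub> m) = (x \<otimes>\<^bsub>S\<^esub> y) \<odot>\<^bsub>P\<^esub> w m"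
      using Wt m by (simp only: B_simps)
    then show "x \<odot>\<^bsub>P\<^esub> W i (y \<odot>\<^bsub>M\<^esub> m) = W (Suc i) (x \<odot>\<^bsub>M\<^esub> (y \<odot>\<^bsub>M\<^esub> m))"
      using M.smult_assoc1[OF xT yT m] P.smult_assoc1[OF xT yT wP[OF m]] Wt[OF y m]
      by (simp add: B_simps)
  qed
  \<comment> \<open>In degree \<open>t [^] n\<close> the twist has coefficient 1, so the rule for
    \<open>w\<close> says that \<open>w\<close> is the sum of \<open>W n\<close> and
    \<open>c\<close>.\<close>
  have Wn: "W n m \<oplus>\<^bsub>P\<^esub> c m = w m" if m: "m \<in> carrier M" for m
  proof (rule translate_unique[OF K M tpow[of n] _ toP[OF w] _ m])
    have "c \<in> additive_maps M B" using c by (auto simp: linear_maps_def hom_def)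
    then show "(\<lambda>m. W n m \<oplus>\<^bsub>P\<^esub> c m) \<in> additive_maps M P"
      using WP cP add_maps[OF toP[OF W]] add_maps[OF toP] by (auto simp: hom_def P.M.a_ac)
    fix x m assume x: "x \<in> A (t [^]\<^bsub>\<Gamma>\<^esub> n)" and m: "m \<in> carrier M"
    have tnH: "t [^]\<^bsub>\<Gamma>\<^esub> n \<in> H" using tpow \<psi>pow by (simp add: HK)
    have "x \<in> carrier S" using component_closed[OF _ x] t(1) by simp
    moreover have "\<kappa> (t [^]\<^bsub>\<Gamma>\<^esub> n) = 1" using n \<psi>pow by (simp add: \<kappa>_def)
    ultimately show "W n (x \<odot>\<^bsub>M\<^esub> m) \<oplus>\<^bsub>P\<^esub> c (x \<odot>\<^bsub>M\<^esub> m) = w (x \<odot>\<^bsub>M\<^esub> m)"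
      using wdeg[OF tnH x m] Wt[OF x m] by (simp add: B_simps add_pow_int_ge)
  qed

  define F where "F j m = finsum P (\<lambda>i. W i m) {..<j}" for j m
  have F0: "F 0 m = \<zero>\<^bsub>P\<^esub>" for m by (simp add: F_def)
  have FSuc: "F (Suc j) m = W j m \<oplus>\<^bsub>P\<^esub> F j m" if "m \<in> carrier M" for j m
    using WP[OF that] by (simp add: F_def lessThan_Suc)
  have FP: "F j m \<in> carrier P" if "m \<in> carrier M" for j m
    using WP[OF that] by (simp add: F_def Pi_def)
  have gF: "g (F j m) = \<zero>\<^bsub>Q\<^esub>" if m: "m \<in> carrier M" for j m
  proof (induction j)
    case 0
    then show ?case using P.linear_maps_zero[OF Q g] by (simp add: F0)
  next
    case (Suc j)
    then show ?case using FSuc FP WP ker(2)[OF W] m gadd by simp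
  qed
  have Fadd: "F j (m \<oplus>\<^bsub>M\<^esub> m') = F j m \<oplus>\<^bsub>P\<^esub> F j m'" if m: "m \<in> carrier M" "m' \<in> carrier M" for j m m'
  proof (induction j)
    case 0
    then show ?case by (simp add: F0)
  next
    case (Suc j)
    then show ?case using FSuc FP WP m add_maps[OF toP[OF W]] by (simp add: P.M.a_ac)
  qed
  have Flin: "F j (x \<odot>\<^bsub>M\<^esub> m) = x \<odot>\<^bsub>P\<^esub> F j m"
    if \<gamma>: "\<gamma> \<in> K" "\<psi> \<gamma> = 0" "x \<in> A \<gamma>" "m \<in> carrier M" for j \<gamma> x m
  proof -
    have "x \<in> homog_span K" using comp \<gamma> by blast
    then show ?thesis
      by (induction j) (simp_all add: F0 FSuc FP WP Wlin[OF \<gamma>] \<gamma>(4) P.smult_r_null P.smult_r_distr)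
  qed
  \<comment> \<open>Telescoping: translating \<open>F j\<close> by \<open>t\<close> drops the term
    \<open>W 0\<close> and gains \<open>W j\<close>.\<close>
  have Fstep: "x \<odot>\<^bsub>P\<^esub> F j m \<oplus>\<^bsub>P\<^esub> W 0 (x \<odot>\<^bsub>M\<^esub> m) = F j (x \<odot>\<^bsub>M\<^esub> m) \<oplus>\<^bsub>P\<^esub> W j (x \<odot>\<^bsub>M\<^esub> m)"
    if x: "x \<in> A t" and m: "m \<in> carrier M" for j x m
  proof -
    have xT: "x \<in> homog_span K" using comp[OF t(1) x] .
    then have xm: "x \<odot>\<^bsub>M\<^esub> m \<in> carrier M" using m by simp
    show ?thesis
    proof (induction j)
      case 0
      then show ?case using xT by (simp add: F0 P.smult_r_null)
    next
      case (Suc j)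
      have "x \<odot>\<^bsub>P\<^esub> F (Suc j) m \<oplus>\<^bsub>P\<^esub> W 0 (x \<odot>\<^bsub>M\<^esub> m) =
          W (Suc j) (x \<odot>\<^bsub>M\<^esub> m) \<oplus>\<^bsub>P\<^esub> (x \<odot>\<^bsub>P\<^esub> F j m \<oplus>\<^bsub>P\<^esub> W 0 (x \<odot>\<^bsub>M\<^esub> m))"
        using xT xm m WP FP by (simp add: FSuc P.smult_r_distr Wstep[OF x m] P.M.a_assoc)
      then show ?case unfolding Suc using xm WP FP by (simp add: FSuc P.M.a_ac)
    qed
  qed

  define k where "k m = s m \<oplus>\<^bsub>P\<^esub> F n m" for m
  have kadd: "k \<in> additive_maps M P"
    using sP FP Fadd add_maps[OF sadd] by (auto simp: hom_def k_def P.M.a_ac)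
  have k0: "k (x \<odot>\<^bsub>M\<^esub> m) = x \<odot>\<^bsub>P\<^esub> k m"
    if \<gamma>: "\<gamma> \<in> K" "\<psi> \<gamma> = 0" "x \<in> A \<gamma>" "m \<in> carrier M" for \<gamma> x m
  proof -
    have "x \<in> homog_span K" using comp \<gamma> by blast
    moreover have "\<gamma> \<in> H" using \<gamma> by (simp add: HK)
    ultimately show ?thesis
      using slin[of \<gamma> x m] Flin[OF \<gamma>] \<gamma> sP FP by (simp add: k_def P.smult_r_distr)
  qed
  have kt: "k (x \<odot>\<^bsub>M\<^esub> m) = x \<odot>\<^bsub>P\<^esub> k m" if x: "x \<in> A t" and m: "m \<in> carrier M" for x m
  proof -
    have xT: "x \<in> homog_span K" using comp[OF t(1) x] .
    then have xm: "x \<odot>\<^bsub>M\<^esub> m \<in> carrier M" using m by simp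
    \<comment> \<open>This is the telescoping identity for \<open>j = n\<close> with
      \<open>w\<close> replaced by \<open>W n\<close> plus \<open>c\<close>. Cancelling
      \<open>W n\<close>, the translate of \<open>F n\<close> falls short of \<open>F n\<close> by
      \<open>c\<close>, exactly what \<open>s1\<close> has in excess of \<open>s\<close>; so their
      sum \<open>k\<close> is invariant.\<close>
    have "(x \<odot>\<^bsub>P\<^esub> F n m \<oplus>\<^bsub>P\<^esub> c (x \<odot>\<^bsub>M\<^esub> m)) \<oplus>\<^bsub>P\<^esub> W n (x \<odot>\<^bsub>M\<^esub> m) = F n (x \<odot>\<^bsub>M\<^esub> m) \<oplus>\<^bsub>P\<^esub> W n (x \<odot>\<^bsub>M\<^esub> m)"
      using Fstep[OF x m, of n] W0[OF xm] Wn[OF xm, symmetric] xT m xm FP WP cP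
      by (simp add: P.M.a_ac)
    then have "x \<odot>\<^bsub>P\<^esub> F n m \<oplus>\<^bsub>P\<^esub> c (x \<odot>\<^bsub>M\<^esub> m) = F n (x \<odot>\<^bsub>M\<^esub> m)"
      using P.M.add.r_cancel[of "W n (x \<odot>\<^bsub>M\<^esub> m)"] xT m xm FP WP cP by simp
    then have "k (x \<odot>\<^bsub>M\<^esub> m) = (c (x \<odot>\<^bsub>M\<^esub> m) \<oplus>\<^bsub>P\<^esub> s (x \<odot>\<^bsub>M\<^esub> m)) \<oplus>\<^bsub>P\<^esub> x \<odot>\<^bsub>P\<^esub> F n m"
      unfolding k_def using xT m xm FP cP sP by (simp add: P.M.a_ac flip: \<open>_ = F n (x \<odot>\<^bsub>M\<^esub> m)\<close>)
    also have "\<dots> = x \<odot>\<^bsub>P\<^esub> s m \<oplus>\<^bsub>P\<^esub> x \<odot>\<^bsub>P\<^esub> F n m"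
      using c_eq[OF xm] s1t[OF x m] by simp
    finally show ?thesis using xT m FP sP by (simp add: k_def P.smult_r_distr)
  qed
  have kpow: "k (x \<odot>\<^bsub>M\<^esub> m) = x \<odot>\<^bsub>P\<^esub> k m" if "x \<in> A (t [^]\<^bsub>\<Gamma>\<^esub> j)" "m \<in> carrier M" for j :: nat and x m
    using that
  proof (induction j arbitrary: x m)
    case 0
    then show ?case using k0[OF K.one_closed \<psi>1] by simp
  next
    case (Suc j)
    have "k (y \<odot>\<^bsub>M\<^esub> m) = y \<odot>\<^bsub>P\<^esub> k m" if "y \<in> A (t [^]\<^bsub>\<Gamma>\<^esub> j) \<union> A t" "m \<in> carrier M" for y m
      using Suc.IH kt that by blast
    then show ?case
      using linear_at_mult[OF K M P kadd tpow[of j] t(1) _ _ Suc.prems(2)] Suc.prems(1) by simp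
  qed
  have kinv: "k (x \<odot>\<^bsub>M\<^esub> m) = x \<odot>\<^bsub>P\<^esub> k m"
    if "x \<in> A (inv\<^bsub>\<Gamma>\<^esub> (t [^]\<^bsub>\<Gamma>\<^esub> j))" "m \<in> carrier M" for j :: nat and x m
    using linear_at_inv[OF K M P kadd tpow[of j] _ that] kpow[of _ j] k0[OF K.one_closed \<psi>1] by blast
  have k: "k \<in> linear_maps (graded_subring S A K) M P"
  proof (rule linear_mapsI[OF K M P kadd])
    fix \<gamma> x m assume \<gamma>: "\<gamma> \<in> K" and x: "x \<in> A \<gamma>" and m: "m \<in> carrier M"
    \<comment> \<open>\<gamma> factors as \<tau> times an element of ker \<psi>, where \<tau> is a
      power of \<open>t\<close> or the inverse of one, according to the sign of \<psi> at \<gamma>.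
      Linearity is known in both degrees.\<close>
    obtain \<tau> where \<tau>: "\<tau> \<in> K" "\<psi> \<tau> = \<psi> \<gamma>"
      and k\<tau>: "\<And>x m. \<lbrakk>x \<in> A \<tau>; m \<in> carrier M\<rbrakk> \<Longrightarrow> k (x \<odot>\<^bsub>M\<^esub> m) = x \<odot>\<^bsub>P\<^esub> k m"
    proof (cases "\<psi> \<gamma> \<ge> 0")
      case True
      then obtain j where j: "\<psi> \<gamma> = int j" by (metis zero_le_imp_eq_int)
      show ?thesis using that[OF tpow[of j]] \<psi>pow[of j] kpow[of _ j] j by simp
    next
      case False
      then obtain j where j: "- \<psi> \<gamma> = int j" by (metis zero_le_imp_eq_int linorder_linear neg_0_le_iff_le)
      have "inv\<^bsub>\<Gamma>\<^esub> (t [^]\<^bsub>\<Gamma>\<^esub> j) \<in> K" "\<psi> (inv\<^bsub>\<Gamma>\<^esub> (t [^]\<^bsub>\<Gamma>\<^esub> j)) = \<psi> \<gamma>"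
        using tpow[of j] \<psi>inv[OF tpow[of j]] \<psi>pow[of j] j by auto
      then show ?thesis using that kinv[of _ j] by blast
    qed
    let ?l = "inv\<^bsub>\<Gamma>\<^esub> \<tau> \<otimes>\<^bsub>\<Gamma>\<^esub> \<gamma>"
    have l: "?l \<in> K" "\<psi> ?l = 0" using \<tau> \<gamma> \<psi> \<psi>inv by simp_all
    have "\<tau> \<otimes>\<^bsub>\<Gamma>\<^esub> ?l = \<gamma>" using \<tau>(1) \<gamma> by (simp add: \<Gamma>.m_assoc[symmetric])
    moreover have "k (y \<odot>\<^bsub>M\<^esub> m) = y \<odot>\<^bsub>P\<^esub> k m" if "y \<in> A \<tau> \<union> A ?l" "m \<in> carrier M" for y m
      using k\<tau> k0[OF l] that by blast
    ultimately show "k (x \<odot>\<^bsub>M\<^esub> m) = x \<odot>\<^bsub>P\<^esub> k m"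
      using linear_at_mult[OF K M P kadd \<tau>(1) l(1) _ _ m, of x] x by simp
  qed
  have "g (k m) = h m" if "m \<in> carrier M" for m
    using gadd[OF sP FP] gs gF that hom_in_carrier[OF hadd] by (simp add: k_def)
  then show "\<exists>k\<in>linear_maps (graded_subring S A K) M P. \<forall>m\<in>carrier M. g (k m) = h m"
    using k by blast
qed

lemma projective_cyclic_extension:
  fixes \<psi> :: "'g \<Rightarrow> int" and n :: nat
  assumes K: "subgroup K \<Gamma>" and H: "subgroup H \<Gamma>" and n: "0 < n"
    and \<psi>: "\<And>\<gamma> \<tau>. \<lbrakk>\<gamma> \<in> K; \<tau> \<in> K\<rbrakk> \<Longrightarrow> \<psi> (\<gamma> \<otimes>\<^bsub>\<Gamma>\<^esub> \<tau>) = \<psi> \<gamma> + \<psi> \<tau>"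
    and t: "t \<in> K" "\<psi> t = 1" and HK: "H = {\<gamma> \<in> K. int n dvd \<psi> \<gamma>}"
    and M: "left_module (graded_subring S A K) M"
    and proj: "projective_module (graded_subring S A H) M"
  shows "projective_module (graded_subring S A K) M"
  using lifts_against_cyclic_extension[OF assms] M unfolding projective_module_def by blast

text \<open>Recognises \<open>H\<close> as a full preimage: its image under \<psi> is some n\<int>
  with n > 0, and a subgroup containing ker \<psi> is the preimage of its image.\<close>

lemma projective_cyclic_extension_kernel:
  fixes \<psi> :: "'g \<Rightarrow> int"
  assumes K: "subgroup K \<Gamma>" and H: "subgroup H \<Gamma>" and HK: "H \<subseteq> K"
    and \<psi>: "\<And>\<gamma> \<tau>. \<lbrakk>\<gamma> \<in> K; \<tau> \<in> K\<rbrakk> \<Longrightarrow> \<psi> (\<gamma> \<otimes>\<^bsub>\<Gamma>\<^esub> \<tau>) = \<psi> \<gamma> + \<psi> \<tau>"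
    and t: "t \<in> K" "\<psi> t = 1" and u: "u \<in> H" "\<psi> u > 0"
    and ker: "\<And>\<gamma>. \<lbrakk>\<gamma> \<in> K; \<psi> \<gamma> = 0\<rbrakk> \<Longrightarrow> \<gamma> \<in> H"
    and M: "left_module (graded_subring S A K) M"
    and proj: "projective_module (graded_subring S A H) M"
  shows "projective_module (graded_subring S A K) M"
proof -
  have \<psi>H: "\<psi> (\<gamma> \<otimes>\<^bsub>\<Gamma>\<^esub> \<tau>) = \<psi> \<gamma> + \<psi> \<tau>" if "\<gamma> \<in> H" "\<tau> \<in> H" for \<gamma> \<tau>
    using \<psi> HK that by blast
  obtain n v where n: "0 < n" and v: "v \<in> H" "\<psi> v = int n"
    and dvd: "\<And>\<gamma>. \<gamma> \<in> H \<Longrightarrow> int n dvd \<psi> \<gamma>"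
    using \<Gamma>.additive_image_generator[of H \<psi>, OF H \<psi>H u] by blast
  have "\<gamma> \<in> H" if \<gamma>: "\<gamma> \<in> K" "int n dvd \<psi> \<gamma>" for \<gamma>
  proof -
    \<comment> \<open>\<open>v [^] q\<close> has the same \<psi>-value as \<gamma>, so the two
      differ by an element of ker \<psi>, which lies in \<open>H\<close>.\<close>
    obtain q where q: "\<psi> \<gamma> = int n * q" using \<gamma>(2) by blast
    note pw = \<Gamma>.additive_int_pow[of H \<psi> v q, OF H \<psi>H v(1)]
    let ?w = "inv\<^bsub>\<Gamma>\<^esub> (v [^]\<^bsub>\<Gamma>\<^esub> q)"
    have wH: "?w \<in> H" by (rule subgroup.m_inv_closed[OF H pw(1)])
    have one: "\<psi> \<one>\<^bsub>\<Gamma>\<^esub> = 0"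
      using \<psi>[OF subgroup.one_closed[OF K] subgroup.one_closed[OF K]] by simp
    have vG: "v [^]\<^bsub>\<Gamma>\<^esub> q \<in> carrier \<Gamma>" "\<gamma> \<in> carrier \<Gamma>"
      using pw(1) \<gamma>(1) subgroup.subset[OF H] subgroup.subset[OF K] by auto
    have "\<psi> (\<gamma> \<otimes>\<^bsub>\<Gamma>\<^esub> ?w) = 0"
      using \<psi>H[OF pw(1) wH] \<psi>[OF \<gamma>(1) subsetD[OF HK wH]] pw(2) v(2) q one vG
      by (simp add: mult.commute)
    then have "\<gamma> \<otimes>\<^bsub>\<Gamma>\<^esub> ?w \<in> H"
      using ker subgroup.m_closed[OF K \<gamma>(1)] wH HK by blast
    then have "\<gamma> \<otimes>\<^bsub>\<Gamma>\<^esub> ?w \<otimes>\<^bsub>\<Gamma>\<^esub> v [^]\<^bsub>\<Gamma>\<^esub> q \<in> H" using subgroup.m_closed[OF H] pw(1) by blast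
    then show ?thesis using vG by (simp add: \<Gamma>.m_assoc)
  qed
  then have "H = {\<gamma> \<in> K. int n dvd \<psi> \<gamma>}" using HK dvd by blast
  then show ?thesis using projective_cyclic_extension[of K H n \<psi> t M] K H n \<psi> t M proj by blast
qed

end

section \<open>The Thompson group\<close>

text \<open>\<open>Y\<close> is meant as the family of images of the generators in a quotient, with
  the relations written without inverses. Moving past \<open>Y 0 [^] p = \<one>\<close> shifts
  indices by \<open>p\<close>, so \<open>Y\<close> is periodic on positive indices.\<close>

lemma (in group) thompson_relations_torsion:
  fixes Y :: "nat \<Rightarrow> 'a" and p :: nat
  assumes Y: "\<And>i. Y i \<in> carrier G" and rel: "\<And>i n. i < n \<Longrightarrow> Y n \<otimes> Y i = Y i \<otimes> Y (Suc n)"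
    and p: "0 < p" "Y 0 [^] p = \<one>"
  shows "0 < n \<Longrightarrow> Y n = Y 1" and "Y 0 \<otimes> Y 1 = Y 1 \<otimes> Y 0"
proof -
  have shift: "Y n \<otimes> Y 0 [^] k = Y 0 [^] k \<otimes> Y (n + k)" if "0 < n" for n k
  proof (induction k)
    case 0
    then show ?case using Y by simp
  next
    case (Suc k)
    have "Y n \<otimes> Y 0 [^] Suc k = (Y n \<otimes> Y 0 [^] k) \<otimes> Y 0" using Y by (simp add: m_assoc)
    also have "\<dots> = Y 0 [^] k \<otimes> (Y (n + k) \<otimes> Y 0)" using Y Suc by (simp add: m_assoc)
    also have "\<dots> = Y 0 [^] Suc k \<otimes> Y (n + Suc k)" using Y rel[of 0 "n + k"] that by (simp add: m_assoc)
    finally show ?case .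
  qed
  have period: "Y (n + p) = Y n" if "0 < n" for n
    using shift[OF that, of p] Y by (simp add: p(2))
  have step: "Y (Suc n) = Y n" if "0 < n" for n
  proof -
    \<comment> \<open>By periodicity the relation for \<open>n < n + p\<close> conjugates
      \<open>Y n\<close> by itself.\<close>
    have "Y n \<otimes> Y n = Y n \<otimes> Y (Suc n)"
      using rel[of n "n + p"] p(1) period[OF that] period[of "Suc n"] by simp
    then show ?thesis using Y by simp
  qed
  show const: "Y n = Y 1" if "0 < n" for n
    using that by (induction n) (metis One_nat_def not_gr_zero step)+
  \<comment> \<open>The relation for \<open>0 < 1\<close> involves \<open>Y 2\<close>, which equals
    \<open>Y 1\<close>.\<close>
  show "Y 0 \<otimes> Y 1 = Y 1 \<otimes> Y 0"
    using rel[of 0 1] const[of 2] by (simp add: numeral_2_eq_2)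
qed

section \<open>Exponent sums as homomorphisms to the integers\<close>

text \<open>The homomorphism from the free group to the integers with value \<open>f a\<close> on
  the generator \<open>a\<close>, read on words.\<close>

definition word_weight :: "('a \<Rightarrow> int) \<Rightarrow> 'a word \<Rightarrow> int"
  where "word_weight f w = (\<Sum>(a, b)\<leftarrow>w. if b then f a else - f a)"

lemma pres_eq_word_weight:
  assumes "pres_eq rels u v" and "\<And>u v. (u, v) \<in> rels \<Longrightarrow> word_weight f u = word_weight f v"
  shows "word_weight f u = word_weight f v"
  using assms(1) by (induction rule: pres_eq.induct) (auto simp: word_weight_def assms(2)[unfolded word_weight_def])

text \<open>Von Dyck's principle: a weight that respects the relations is constant on classes and so
  descends to the presented group.\<close>

lemma presented_group_weight:
  assumes "\<And>u v. (u, v) \<in> rels \<Longrightarrow> word_weight f u = word_weight f v"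
  shows "\<exists>\<phi>. (\<forall>u. \<phi> (pres_class rels u) = word_weight f u) \<and>
    (\<forall>x\<in>carrier (presented_group rels). \<forall>y\<in>carrier (presented_group rels).
      \<phi> (x \<otimes>\<^bsub>presented_group rels\<^esub> y) = \<phi> x + \<phi> y)"
proof (intro exI conjI allI ballI)
  \<comment> \<open>The weight of a class is read off an arbitrary representative.\<close>
  let ?\<phi> = "\<lambda>C. word_weight f (SOME u. pres_class rels u = C)"
  show \<phi>: "?\<phi> (pres_class rels u) = word_weight f u" for u
    using pres_eq_word_weight[OF _ assms] someI[of "\<lambda>v. pres_class rels v = pres_class rels u" u]
    by (auto simp: pres_class_eq_iff)
  fix x y assume "x \<in> carrier (presented_group rels)" "y \<in> carrier (presented_group rels)"
  then obtain u v where "x = pres_class rels u" "y = pres_class rels v"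
    by (auto simp: presented_group_def)
  then show "?\<phi> (x \<otimes>\<^bsub>presented_group rels\<^esub> y) = ?\<phi> x + ?\<phi> y"
    by (simp only: presented_group_mult \<phi>) (simp add: word_weight_def)
qed

section \<open>The generators of the Thompson group\<close>

abbreviation thompson_generator :: "nat \<Rightarrow> nat word set"
  where "thompson_generator i \<equiv> pres_class thompson_relations [(i, True)]"

lemma thompson_generator_closed: "thompson_generator i \<in> carrier thompson_group"
  by (simp add: thompson_group_def presented_group_def)

lemma thompson_group_mult:
  "pres_class thompson_relations u \<otimes>\<^bsub>thompson_group\<^esub> pres_class thompson_relations v =
    pres_class thompson_relations (u @ v)"
  unfolding thompson_group_def by (rule presented_group_mult)

lemma thompson_group_one: "\<one>\<^bsub>thompson_group\<^esub> = pres_class thompson_relations []"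
  by (simp add: thompson_group_def presented_group_def)

lemma thompson_generator_inv:
  "inv\<^bsub>thompson_group\<^esub> (thompson_generator i) = pres_class thompson_relations [(i, False)]"
proof -
  interpret group thompson_group by (rule group_thompson_group)
  have "pres_class thompson_relations [(i, False)] \<otimes>\<^bsub>thompson_group\<^esub> thompson_generator i = \<one>\<^bsub>thompson_group\<^esub>"
    using pres_eq.cancel[of thompson_relations i False]
    by (simp add: thompson_group_mult thompson_group_one pres_class_eq_iff)
  then show ?thesis
    by (intro inv_equality thompson_generator_closed) (simp_all add: thompson_group_def presented_group_def)
qed

lemma thompson_generator_relation:
  assumes "i < n"
  shows "thompson_generator n \<otimes>\<^bsub>thompson_group\<^esub> thompson_generator i =
    thompson_generator i \<otimes>\<^bsub>thompson_group\<^esub> thompson_generator (Suc n)"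
proof -
  interpret group thompson_group by (rule group_thompson_group)
  have "pres_eq thompson_relations [(i, False), (n, True), (i, True)] [(n + 1, True)]"
    using assms by (intro pres_eq.rel) (auto simp: thompson_relations_def)
  then have "thompson_generator (Suc n) =
      inv\<^bsub>thompson_group\<^esub> (thompson_generator i) \<otimes>\<^bsub>thompson_group\<^esub>
        (thompson_generator n \<otimes>\<^bsub>thompson_group\<^esub> thompson_generator i)"
    by (simp add: thompson_generator_inv thompson_group_mult pres_class_eq_iff pres_eq.sym)
  then show ?thesis
    using thompson_generator_closed by (simp add: m_assoc[symmetric])
qed

section \<open>Subgroups of finite index in the Thompson group\<close>

text \<open>In the quotient by the core \<open>N\<close> all generators of positive index have the
  same image, and it commutes with that of \<open>thompson_generator 0\<close>. A word becomes a
  product of two powers, the exponents being its exponent sums in generator 0 and in all others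
  together; if both vanish, it lies in \<open>N\<close> and so in \<open>H\<close>.\<close>

lemma thompson_finite_index:
  assumes H: "subgroup H thompson_group" and fin: "finite (rcosets\<^bsub>thompson_group\<^esub> H)"
  shows "\<exists>p>0. thompson_generator i [^]\<^bsub>thompson_group\<^esub> (p::nat) \<in> H"
    and "\<lbrakk>word_weight (\<lambda>a. if a = 0 then 1 else 0) u = 0; word_weight (\<lambda>a. if a = 0 then 0 else 1) u = 0\<rbrakk> \<Longrightarrow>
      pres_class thompson_relations u \<in> H"
proof -
  let ?G = thompson_group and ?c = "pres_class thompson_relations"
  interpret G: group ?G by (rule group_thompson_group)
  obtain N where N: "N \<lhd> ?G" "N \<subseteq> H"
    and tors: "\<And>x. x \<in> carrier ?G \<Longrightarrow> \<exists>p>0. x [^]\<^bsub>?G\<^esub> (p::nat) \<in> N"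
    using G.finite_index_core[OF H fin] by blast
  show "\<exists>p>0. thompson_generator i [^]\<^bsub>?G\<^esub> (p::nat) \<in> H"
    using tors[OF thompson_generator_closed] N(2) by blast
  assume u: "word_weight (\<lambda>a. if a = 0 then 1 else 0) u = 0"
    "word_weight (\<lambda>a. if a = 0 then 0 else 1) u = 0"
  interpret N: normal N ?G by fact
  interpret Q: group "?G Mod N" by (rule N.factorgroup_is_group)
  interpret \<pi>: group_hom ?G "?G Mod N" "\<lambda>g. N #>\<^bsub>?G\<^esub> g"
    by (intro group_hom.intro group_hom_axioms.intro G.is_group Q.is_group N.r_coset_hom_Mod)
  have ker: "g \<in> N" if "g \<in> carrier ?G" "N #>\<^bsub>?G\<^esub> g = \<one>\<^bsub>?G Mod N\<^esub>" for g
    using G.coset_join1[OF _ that(1) N.subgroup_axioms] that(2) by (simp add: FactGroup_def N.subset)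
  have c: "?c w \<in> carrier ?G" for w by (simp add: thompson_group_def presented_group_def)
  define Y where "Y i = N #>\<^bsub>?G\<^esub> thompson_generator i" for i
  have Y: "Y i \<in> carrier (?G Mod N)" for i
    unfolding Y_def by (rule \<pi>.hom_closed[OF thompson_generator_closed])
  have rel: "Y n \<otimes>\<^bsub>?G Mod N\<^esub> Y i = Y i \<otimes>\<^bsub>?G Mod N\<^esub> Y (Suc n)" if "i < n" for i n
    unfolding Y_def using thompson_generator_relation[OF that]
    by (simp only: \<pi>.hom_mult[OF c c, symmetric])
  obtain p :: nat where p: "0 < p" "thompson_generator 0 [^]\<^bsub>?G\<^esub> p \<in> N"
    using tors[OF thompson_generator_closed] by blast
  have "Y 0 [^]\<^bsub>?G Mod N\<^esub> p = N #>\<^bsub>?G\<^esub> (thompson_generator 0 [^]\<^bsub>?G\<^esub> p)"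
    unfolding Y_def by (rule \<pi>.hom_nat_pow[OF thompson_generator_closed, symmetric])
  also have "\<dots> = \<one>\<^bsub>?G Mod N\<^esub>"
    using G.coset_join2[OF _ N.subgroup_axioms p(2)] thompson_generator_closed by (simp add: FactGroup_def)
  finally have "Y 0 [^]\<^bsub>?G Mod N\<^esub> p = \<one>\<^bsub>?G Mod N\<^esub>" .
  note Yconst = Q.thompson_relations_torsion(1)[where Y = Y, OF Y rel p(1) this]
    and Ycomm = Q.thompson_relations_torsion(2)[where Y = Y, OF Y rel p(1) this]
  \<comment> \<open>Induction on the word: each letter is absorbed into one of the two commuting
    powers.\<close>
  have form: "N #>\<^bsub>?G\<^esub> ?c w =
      Y 0 [^]\<^bsub>?G Mod N\<^esub> word_weight (\<lambda>a. if a = 0 then 1 else 0) w \<otimes>\<^bsub>?G Mod N\<^esub>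
      Y 1 [^]\<^bsub>?G Mod N\<^esub> word_weight (\<lambda>a. if a = 0 then 0 else 1) w" for w
  proof (induction w)
    case Nil
    have "word_weight f [] = 0" for f :: "nat \<Rightarrow> int" by (simp add: word_weight_def)
    then show ?case
      by (simp only: \<pi>.hom_one int_pow_0 Q.r_one[OF Q.one_closed] flip: thompson_group_one)
  next
    case (Cons l w)
    obtain a b where l: "l = (a, b)" by (cases l)
    let ?e = "if b then 1 else - 1 :: int"
    let ?i = "word_weight (\<lambda>a. if a = 0 then 1 else 0) w"
    let ?j = "word_weight (\<lambda>a. if a = 0 then 0 else 1) w"
    have "N #>\<^bsub>?G\<^esub> ?c [l] = Y a [^]\<^bsub>?G Mod N\<^esub> ?e"
      using Y \<pi>.hom_inv[OF thompson_generator_closed, of a]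
      by (simp add: l Y_def thompson_generator_inv Q.int_pow_neg)
    also have "Y a = (if a = 0 then Y 0 else Y 1)" using Yconst[of a] by simp
    finally have hd: "N #>\<^bsub>?G\<^esub> ?c [l] = (if a = 0 then Y 0 else Y 1) [^]\<^bsub>?G Mod N\<^esub> ?e" .
    have "N #>\<^bsub>?G\<^esub> ?c (l # w) = (N #>\<^bsub>?G\<^esub> ?c [l]) \<otimes>\<^bsub>?G Mod N\<^esub> (N #>\<^bsub>?G\<^esub> ?c w)"
      using \<pi>.hom_mult[OF c c, of "[l]" w] by (simp add: thompson_group_mult)
    also have "\<dots> = (if a = 0 then Y 0 else Y 1) [^]\<^bsub>?G Mod N\<^esub> ?e \<otimes>\<^bsub>?G Mod N\<^esub>
        (Y 0 [^]\<^bsub>?G Mod N\<^esub> ?i \<otimes>\<^bsub>?G Mod N\<^esub> Y 1 [^]\<^bsub>?G Mod N\<^esub> ?j)"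
      unfolding hd Cons ..
    also have "\<dots> = Y 0 [^]\<^bsub>?G Mod N\<^esub> (if a = 0 then ?e + ?i else ?i) \<otimes>\<^bsub>?G Mod N\<^esub>
        Y 1 [^]\<^bsub>?G Mod N\<^esub> (if a = 0 then ?j else ?e + ?j)"
      by (rule Q.commuting_powers_mult[OF Y Y Ycomm])
    finally show ?case by (auto simp: word_weight_def l)
  qed
  have "N #>\<^bsub>?G\<^esub> ?c u = \<one>\<^bsub>?G Mod N\<^esub>" 
    using form[of u] unfolding u by (simp only: int_pow_0 Q.r_one[OF Q.one_closed])
  then show "?c u \<in> H" using ker[OF c] N(2) by blast
qed

section \<open>The two steps from \<open>H\<close> through \<open>K\<close> to the whole
  group\<close>

theorem corollary1p5:
  shows "moore_conjecture TYPE('r) TYPE('s) TYPE('m) thompson_group"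
  unfolding moore_conjecture_def moore_conjecture_triple_def
proof (intro allI impI)
  fix R :: "'r ring" and H and S :: "'s ring" and A :: "nat word set \<Rightarrow> 's set" and M :: "('s, 'm) module"
  let ?G = thompson_group
  assume R: "ring R" and H: "subgroup H ?G" and fin: "finite (rcosets\<^bsub>?G\<^esub> H)"
    and grading: "strongly_graded_ring ?G R S A"
    and M: "left_module S M" and proj: "projective_module (graded_subring S A H) M"
  interpret strong_grading ?G S A by (rule strong_gradingI[OF group_thompson_group R grading])
  define f\<^sub>0 f\<^sub>1 :: "nat \<Rightarrow> int" where f: "f\<^sub>0 = (\<lambda>a. if a = 0 then 1 else 0)" "f\<^sub>1 = (\<lambda>a. if a = 0 then 0 else 1)"
  \<comment> \<open>The conjugating letters cancel, and \<open>i < n\<close> makes both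
    \<open>n\<close> and \<open>n + 1\<close> positive, so the weights do not tell them
    apart.\<close>
  have weight: "word_weight f\<^sub>0 u = word_weight f\<^sub>0 v" "word_weight f\<^sub>1 u = word_weight f\<^sub>1 v"
    if "(u, v) \<in> thompson_relations" for u v
    using that by (auto simp: thompson_relations_def word_weight_def f)
  obtain \<phi>\<^sub>0 where \<phi>\<^sub>0: "\<And>u. \<phi>\<^sub>0 (pres_class thompson_relations u) = word_weight f\<^sub>0 u"
      "\<And>x y. \<lbrakk>x \<in> carrier ?G; y \<in> carrier ?G\<rbrakk> \<Longrightarrow> \<phi>\<^sub>0 (x \<otimes>\<^bsub>?G\<^esub> y) = \<phi>\<^sub>0 x + \<phi>\<^sub>0 y"
    using presented_group_weight[of thompson_relations f\<^sub>0, OF weight(1), folded thompson_group_def]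
    by blast
  obtain \<phi>\<^sub>1 where \<phi>\<^sub>1: "\<And>u. \<phi>\<^sub>1 (pres_class thompson_relations u) = word_weight f\<^sub>1 u"
      "\<And>x y. \<lbrakk>x \<in> carrier ?G; y \<in> carrier ?G\<rbrakk> \<Longrightarrow> \<phi>\<^sub>1 (x \<otimes>\<^bsub>?G\<^esub> y) = \<phi>\<^sub>1 x + \<phi>\<^sub>1 y"
    using presented_group_weight[of thompson_relations f\<^sub>1, OF weight(2), folded thompson_group_def]
    by blast
  note HG = subgroup.subset[OF H]
  have ker: "x \<in> H" if x: "x \<in> carrier ?G" "\<phi>\<^sub>0 x = 0" "\<phi>\<^sub>1 x = 0" for x
  proof -
    obtain w where w: "x = pres_class thompson_relations w"
      using x(1) by (auto simp: thompson_group_def presented_group_def)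
    show ?thesis
      using thompson_finite_index(2)[OF H fin, of w] x(2,3) by (simp add: w \<phi>\<^sub>0(1) \<phi>\<^sub>1(1) f)
  qed
  let ?x = thompson_generator
  have x_values: "\<phi>\<^sub>0 (?x 0) = 1" "\<phi>\<^sub>0 (?x 1) = 0" "\<phi>\<^sub>1 (?x 1) = 1"
    by (simp_all add: \<phi>\<^sub>0(1) \<phi>\<^sub>1(1) word_weight_def f)
  have x_closed: "?x i \<in> carrier ?G" for i by (rule thompson_generator_closed)
  have pow0: "\<phi>\<^sub>0 (x [^]\<^bsub>?G\<^esub> k) = k * \<phi>\<^sub>0 x" if "x \<in> carrier ?G" for x and k :: int
    by (rule \<Gamma>.additive_int_pow(2)[OF \<Gamma>.subgroup_self \<phi>\<^sub>0(2) that])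
  have pow1: "\<phi>\<^sub>1 (x [^]\<^bsub>?G\<^esub> k) = k * \<phi>\<^sub>1 x" if "x \<in> carrier ?G" for x and k :: int
    by (rule \<Gamma>.additive_int_pow(2)[OF \<Gamma>.subgroup_self \<phi>\<^sub>1(2) that])
  have powH: "\<exists>p>0. ?x i [^]\<^bsub>?G\<^esub> int p \<in> H" for i
    using thompson_finite_index(1)[OF H fin] by (simp add: int_pow_int)

  obtain p where p: "p > 0" "?x 0 [^]\<^bsub>?G\<^esub> int p \<in> H" using powH by blast
  have "\<phi>\<^sub>0 (?x 0 [^]\<^bsub>?G\<^esub> int p) > 0" using p(1) pow0[OF x_closed] x_values by simp
  then obtain a v where a: "0 < a" and v: "v \<in> H" "\<phi>\<^sub>0 v = int a"
    and a_dvd: "\<And>x. x \<in> H \<Longrightarrow> int a dvd \<phi>\<^sub>0 x"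
    using \<Gamma>.additive_image_generator[of H \<phi>\<^sub>0, OF H _ p(2)] \<phi>\<^sub>0(2) HG by (auto simp: subset_iff)
  have vG: "v \<in> carrier ?G" using v(1) HG by blast
  \<comment> \<open>The intermediate group is the preimage under \<open>\<phi>\<^sub>0\<close> of
    the image a\<int> of \<open>H\<close>, so it contains \<open>H\<close>.\<close>
  define K where "K = {x \<in> carrier ?G. int a dvd \<phi>\<^sub>0 x}"
  \<comment> \<open>\<open>\<phi>\<^sub>1\<close> is corrected so as to vanish at \<open>v\<close>.
    On \<open>K\<close> the kernel then consists of powers of \<open>v\<close> times the common
    kernel of \<open>\<phi>\<^sub>0\<close> and \<open>\<phi>\<^sub>1\<close>, and both factors lie
    in \<open>H\<close>.\<close>
  define \<psi> where "\<psi> x = \<phi>\<^sub>1 x - (\<phi>\<^sub>0 x div int a) * \<phi>\<^sub>1 v" for x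
  have \<phi>\<^sub>0_one: "\<phi>\<^sub>0 \<one>\<^bsub>?G\<^esub> = 0" using \<phi>\<^sub>0(2)[OF \<Gamma>.one_closed \<Gamma>.one_closed] by simp
  have \<phi>\<^sub>0_inv: "\<phi>\<^sub>0 (inv\<^bsub>?G\<^esub> x) = - \<phi>\<^sub>0 x" if "x \<in> carrier ?G" for x
    using \<phi>\<^sub>0(2)[OF \<Gamma>.inv_closed[OF that] that] \<phi>\<^sub>0_one that by simp
  have K: "subgroup K ?G"
  proof (rule \<Gamma>.subgroupI)
    show "K \<noteq> {}" using \<phi>\<^sub>0_one by (auto simp: K_def)
  qed (auto simp: K_def \<phi>\<^sub>0(2) \<phi>\<^sub>0_inv)
  have MG: "left_module (graded_subring S A (carrier ?G)) M"
    and SG: "graded_subring S A (carrier ?G) = S"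
    using M homog_span_carrier by (simp_all add: graded_subring_def)
  have MK: "left_module (graded_subring S A K) M"
    by (rule left_module_subgroup[OF K \<Gamma>.subgroup_self subgroup.subset[OF K] MG])
  obtain q where q: "q > 0" "?x 1 [^]\<^bsub>?G\<^esub> int q \<in> H" using powH by blast
  \<comment> \<open>Lower step, from \<open>H\<close> to \<open>K\<close>: \<open>?x 1\<close> lies
    in \<open>K\<close> because \<open>\<phi>\<^sub>0\<close> vanishes on it, and its power with
    exponent \<open>q\<close> lies in \<open>H\<close>.\<close>
  have projK: "projective_module (graded_subring S A K) M"
  proof (rule projective_cyclic_extension_kernel[where \<psi> = \<psi>, OF K H _ _ _ _ _ _ _ MK proj])
    show "H \<subseteq> K" using HG a_dvd by (auto simp: K_def)
    show "\<psi> (x \<otimes>\<^bsub>?G\<^esub> y) = \<psi> x + \<psi> y" if "x \<in> K" "y \<in> K" for x y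
      using that by (simp add: K_def \<psi>_def \<phi>\<^sub>0(2) \<phi>\<^sub>1(2) div_plus_div_distrib_dvd_left algebra_simps)
    show "?x 1 \<in> K" "\<psi> (?x 1) = 1" using x_closed x_values by (simp_all add: K_def \<psi>_def)
    show "?x 1 [^]\<^bsub>?G\<^esub> int q \<in> H" by (rule q(2))
    show "\<psi> (?x 1 [^]\<^bsub>?G\<^esub> int q) > 0"
      using q(1) pow0[OF x_closed] pow1[OF x_closed] x_values by (simp add: \<psi>_def)
    show "x \<in> H" if x: "x \<in> K" "\<psi> x = 0" for x
    proof -
      have xG: "x \<in> carrier ?G" using x(1) by (simp add: K_def)
      obtain j where j: "\<phi>\<^sub>0 x = int a * j" using x(1) by (auto simp: K_def)
      \<comment> \<open>Multiplying \<open>x\<close> by this power makes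
        \<open>\<phi>\<^sub>0\<close> vanish, and then also \<open>\<phi>\<^sub>1\<close>, because
        \<psi> is 0 at \<open>x\<close>.\<close>
      let ?y = "v [^]\<^bsub>?G\<^esub> (- j)"
      have yG: "?y \<in> carrier ?G" using vG by simp
      have "\<phi>\<^sub>0 (x \<otimes>\<^bsub>?G\<^esub> ?y) = 0" using \<phi>\<^sub>0(2)[OF xG yG] pow0[OF vG, of "- j"] v(2) j by simp
      moreover have "\<phi>\<^sub>1 (x \<otimes>\<^bsub>?G\<^esub> ?y) = 0"
        using \<phi>\<^sub>1(2)[OF xG yG] pow1[OF vG, of "- j"] x(2) a j by (simp add: \<psi>_def)
      ultimately have "x \<otimes>\<^bsub>?G\<^esub> ?y \<in> H" using ker xG yG by blast
      moreover have "v [^]\<^bsub>?G\<^esub> j \<in> H"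
        using \<Gamma>.additive_int_pow(1)[of H "\<lambda>_. 0", OF H _ v(1)] by simp
      ultimately have "x \<otimes>\<^bsub>?G\<^esub> ?y \<otimes>\<^bsub>?G\<^esub> v [^]\<^bsub>?G\<^esub> j \<in> H" by (rule subgroup.m_closed[OF H])
      then show ?thesis using xG vG by (simp add: \<Gamma>.m_assoc \<Gamma>.int_pow_neg)
    qed
  qed
  \<comment> \<open>Upper step, from \<open>K\<close> to the whole group, with
    \<open>\<phi>\<^sub>0\<close> as the map to the integers and \<open>?x 0\<close> as the element
    of value 1.\<close>
  show "projective_module S M"
    using projective_cyclic_extension[of "carrier ?G" K a \<phi>\<^sub>0 "?x 0" M,
        OF \<Gamma>.subgroup_self K a \<phi>\<^sub>0(2) x_closed x_values(1) K_def MG projK] SG by simp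
qed

end
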